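(* Let $E$ be a set, $I\subseteq E\times E$ an irreflexive symmetric relation, and $M(E,I)$ the corresponding free partially commutative monoid. For every integer $m\geq -1$, the first homology group $H_1(X_m^{\bullet})$ of the right pointed $M(E,I)$-set $X_m^{\bullet}$ defined in the context is a free abelian group.
   Context: Free partially commutative monoid: for a set $E$ and an irreflexive symmetric relation $I\subseteq E\times E$, $M(E,I)$ is the monoid with generating set $E$ and relations $ab=ba$ for all $(a,b)\in I$. The $M(E,I)$-sets $X_n^{\bullet}$: for $n\geq 0$, $X_n^{\bullet}=\{x_0,x_1,\dots,x_n,*\}$ is a pointed set with $n+2$ distinct elements and base point $*$, with the right action of $M(E,I)$ determined by $x_i\cdot e=x_{i+1}$ for $0\leq i\leq n-1$, $x_n\cdot e=*$, $*\cdot e=*$, for all $e\in E$. For $n=-1$, $X_{-1}^{\bullet}=\{*\}$ is the one-point set with trivial action. Homology: for a right $M(E,I)$-set $X$, let $\mathscr{K}_*(X)$ (also written $(M(E,I)/X)^{op}$) be the small category whose objects are all elements of $X$ (including $*$) and whose morphisms $x\to x'$ are the triples $(x,\mu,x')$ with $\mu\in M(E,I)$ and $x\cdot\mu=x'$; the composite of $x\xrightarrow{\mu}x'$ followed by $x'\xrightarrow{\nu}x''$ is $x\xrightarrow{\mu\nu}x''$. Put $H_k(X)=\varinjlim_k^{\mathscr{K}_*(X)}\Delta\mathbb{Z}$, the $k$-th left derived functor of the colimit functor $\varinjlim:\mathrm{Ab}^{\mathscr{K}_*(X)}\to\mathrm{Ab}$ evaluated at the constant functor $\Delta\mathbb{Z}$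 (with value $\mathbb{Z}$ on objects and $1_{\mathbb{Z}}$ on morphisms). Equivalently, this is the integral homology of the nerve of $\mathscr{K}_*(X)$. *)

theory Defs
  imports "HOL-Algebra.Free_Abelian_Groups"
begin

section \<open>Free partially commutative monoids\<close>

text \<open>The least congruence on the free monoid of words over \<open>E\<close> that identifies \<open>ab\<close> with \<open>ba\<close>
  for all \<open>(a, b) \<in> I\<close>.\<close>

inductive_set trace_rel :: "'e set \<Rightarrow> ('e \<times> 'e) set \<Rightarrow> ('e list \<times> 'e list) set"
  for E I where
  trace_comm: "(a, b) \<in> I \<Longrightarrow> ([a, b], [b, a]) \<in> trace_rel E I"
| trace_refl: "u \<in> lists E \<Longrightarrow> (u, u) \<in> trace_rel E I"
| trace_sym: "(u, v) \<in> trace_rel E I \<Longrightarrow> (v, u) \<in> trace_rel E I"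
| trace_trans: "(u, v) \<in> trace_rel E I \<Longrightarrow> (v, w) \<in> trace_rel E I \<Longrightarrow> (u, w) \<in> trace_rel E I"
| trace_append: "(u, v) \<in> trace_rel E I \<Longrightarrow> (u', v') \<in> trace_rel E I \<Longrightarrow>
    (u @ u', v @ v') \<in> trace_rel E I"

definition trace_monoid :: "'e set \<Rightarrow> ('e \<times> 'e) set \<Rightarrow> 'e list set monoid" where
  "trace_monoid E I =
     \<lparr>carrier = lists E // trace_rel E I,
      monoid.mult = (\<lambda>A B. \<Union>u\<in>A. \<Union>v\<in>B. trace_rel E I `` {u @ v}),
      one = trace_rel E I `` {[]}\<rparr>"

lemma trace_rel_lists:
  assumes "I \<subseteq> E \<times> E" "(u, v) \<in> trace_rel E I"
  shows "u \<in> lists E \<and> v \<in> lists E"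
  using assms(2) by induction (use assms(1) in auto)

lemma equiv_trace_rel:
  assumes "I \<subseteq> E \<times> E"
  shows "equiv (lists E) (trace_rel E I)"
proof (rule equivI)
  show "trace_rel E I \<subseteq> lists E \<times> lists E"
    using trace_rel_lists[OF assms] by auto
  show "refl_on (lists E) (trace_rel E I)"
    by (auto intro!: refl_onI trace_refl)
  show "sym (trace_rel E I)" by (auto intro!: symI trace_sym)
  show "trans (trace_rel E I)" by (rule transI) (rule trace_trans)
qed

lemma trace_monoid_mult:
  assumes "I \<subseteq> E \<times> E" "u \<in> lists E" "v \<in> lists E"
  shows "(trace_rel E I `` {u}) \<otimes>\<^bsub>trace_monoid E I\<^esub> (trace_rel E I `` {v})
    = trace_rel E I `` {u @ v}"
proof -
  let ?R = "trace_rel E I"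
  have eq: "?R `` {u' @ v'} = ?R `` {u @ v}" if "(u, u') \<in> ?R" "(v, v') \<in> ?R" for u' v'
    using equiv_class_eq[OF equiv_trace_rel[OF assms(1)] trace_append[OF that]] by simp
  have "(\<Union>u'\<in>?R `` {u}. \<Union>v'\<in>?R `` {v}. ?R `` {u' @ v'})
      = (\<Union>u'\<in>?R `` {u}. \<Union>v'\<in>?R `` {v}. ?R `` {u @ v})"
    using eq by auto
  also have "\<dots> = ?R `` {u @ v}"
    using trace_refl[OF assms(2)] trace_refl[OF assms(3)] by auto
  finally show ?thesis by (simp add: trace_monoid_def)
qed

lemma monoid_trace_monoid:
  assumes "I \<subseteq> E \<times> E"
  shows "monoid (trace_monoid E I)"
proof -
  let ?M = "trace_monoid E I" and ?R = "trace_rel E I"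
  have rep: "\<exists>u\<in>lists E. A = ?R `` {u}" if "A \<in> carrier ?M" for A
    using that by (auto simp: trace_monoid_def elim!: quotientE)
  have cl: "?R `` {u} \<in> carrier ?M" if "u \<in> lists E" for u
    using that by (simp add: trace_monoid_def quotientI)
  have one: "\<one>\<^bsub>?M\<^esub> = ?R `` {[]}" by (simp add: trace_monoid_def)
  note mult = trace_monoid_mult[OF assms]
  show ?thesis
  proof
    fix A B assume "A \<in> carrier ?M" "B \<in> carrier ?M"
    then obtain u v where "u \<in> lists E" "v \<in> lists E" "A = ?R `` {u}" "B = ?R `` {v}"
      using rep by meson
    then show "A \<otimes>\<^bsub>?M\<^esub> B \<in> carrier ?M"
      by (simp add: mult cl)
  next
    fix A B D assume "A \<in> carrier ?M" "B \<in> carrier ?M" "D \<in> carrier ?M"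
    then obtain u v w where "u \<in> lists E" "v \<in> lists E" "w \<in> lists E"
        "A = ?R `` {u}" "B = ?R `` {v}" "D = ?R `` {w}"
      using rep by meson
    then show "A \<otimes>\<^bsub>?M\<^esub> B \<otimes>\<^bsub>?M\<^esub> D = A \<otimes>\<^bsub>?M\<^esub> (B \<otimes>\<^bsub>?M\<^esub> D)"
      by (simp add: mult)
  next
    show "\<one>\<^bsub>?M\<^esub> \<in> carrier ?M" by (simp add: one cl)
  next
    fix A assume "A \<in> carrier ?M"
    then obtain u where u: "u \<in> lists E" "A = ?R `` {u}" using rep by meson
    then show "\<one>\<^bsub>?M\<^esub> \<otimes>\<^bsub>?M\<^esub> A = A" "A \<otimes>\<^bsub>?M\<^esub> \<one>\<^bsub>?M\<^esub> = A"
      using mult[of "[]" u] mult[of u "[]"] by (simp_all add: one)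
  qed
qed


section \<open>Small categories and functors to abelian groups\<close>

text \<open>Composition is written in diagrammatic order: \<open>Comp C f g\<close> is \<open>f\<close> followed by \<open>g\<close>.\<close>

record ('o, 'a) cat =
  Obj :: "'o set"
  Arr :: "'a set"
  Dom :: "'a \<Rightarrow> 'o"
  Cod :: "'a \<Rightarrow> 'o"
  Ident :: "'o \<Rightarrow> 'a"
  Comp :: "'a \<Rightarrow> 'a \<Rightarrow> 'a"

locale small_category =
  fixes C :: "('o, 'a) cat"
  assumes Dom_in: "f \<in> Arr C \<Longrightarrow> Dom C f \<in> Obj C"
    and Cod_in: "f \<in> Arr C \<Longrightarrow> Cod C f \<in> Obj C"
    and Ident_in: "x \<in> Obj C \<Longrightarrow> Ident C x \<in> Arr C"
    and Dom_Ident: "x \<in> Obj C \<Longrightarrow> Dom C (Ident C x) = x"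
    and Cod_Ident: "x \<in> Obj C \<Longrightarrow> Cod C (Ident C x) = x"
    and Comp_in: "\<lbrakk>f \<in> Arr C; g \<in> Arr C; Cod C f = Dom C g\<rbrakk> \<Longrightarrow> Comp C f g \<in> Arr C"
    and Dom_Comp: "\<lbrakk>f \<in> Arr C; g \<in> Arr C; Cod C f = Dom C g\<rbrakk> \<Longrightarrow> Dom C (Comp C f g) = Dom C f"
    and Cod_Comp: "\<lbrakk>f \<in> Arr C; g \<in> Arr C; Cod C f = Dom C g\<rbrakk> \<Longrightarrow> Cod C (Comp C f g) = Cod C g"
    and Ident_Comp: "f \<in> Arr C \<Longrightarrow> Comp C (Ident C (Dom C f)) f = f"
    and Comp_Ident: "f \<in> Arr C \<Longrightarrow> Comp C f (Ident C (Cod C f)) = f"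
    and Comp_assoc: "\<lbrakk>f \<in> Arr C; g \<in> Arr C; h \<in> Arr C; Cod C f = Dom C g; Cod C g = Dom C h\<rbrakk>
      \<Longrightarrow> Comp C (Comp C f g) h = Comp C f (Comp C g h)"

record ('o, 'a, 'g) abfun =
  On_obj :: "'o \<Rightarrow> 'g monoid"
  On_arr :: "'a \<Rightarrow> 'g \<Rightarrow> 'g"

locale ab_functor =
  fixes C :: "('o, 'a) cat" and F :: "('o, 'a, 'g) abfun"
  assumes On_obj_comm_group: "x \<in> Obj C \<Longrightarrow> comm_group (On_obj F x)"
    and On_arr_hom: "f \<in> Arr C \<Longrightarrow> On_arr F f \<in> hom (On_obj F (Dom C f)) (On_obj F (Cod C f))"
    and On_arr_Ident: "\<lbrakk>x \<in> Obj C; a \<in> carrier (On_obj F x)\<rbrakk> \<Longrightarrow> On_arr F (Ident C x) a = a"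
    and On_arr_Comp: "\<lbrakk>f \<in> Arr C; g \<in> Arr C; Cod C f = Dom C g; a \<in> carrier (On_obj F (Dom C f))\<rbrakk>
      \<Longrightarrow> On_arr F (Comp C f g) a = On_arr F g (On_arr F f a)"

definition nat_trans ::
  "('o, 'a) cat \<Rightarrow> ('o, 'a, 'g) abfun \<Rightarrow> ('o, 'a, 'h) abfun \<Rightarrow> ('o \<Rightarrow> 'g \<Rightarrow> 'h) \<Rightarrow> bool" where
  "nat_trans C F G \<eta> \<longleftrightarrow>
     (\<forall>x\<in>Obj C. \<eta> x \<in> hom (On_obj F x) (On_obj G x)) \<and>
     (\<forall>f\<in>Arr C. \<forall>a\<in>carrier (On_obj F (Dom C f)).
        \<eta> (Cod C f) (On_arr F f a) = On_arr G f (\<eta> (Dom C f) a))"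

definition const_int :: "('o, 'a, int) abfun" where
  "const_int = \<lparr>On_obj = (\<lambda>_. integer_group), On_arr = (\<lambda>_ n. n)\<rparr>"


section \<open>The colimit functor\<close>

text \<open>The colimit of \<open>F\<close> is the quotient of the direct sum of the groups \<open>F x\<close> by the subgroup
  generated by the elements \<open>F f a - a\<close> for all arrows \<open>f\<close> and all \<open>a \<in> F (Dom f)\<close>.\<close>

definition colim_in :: "('o, 'a) cat \<Rightarrow> ('o, 'a, 'g) abfun \<Rightarrow> 'o \<Rightarrow> 'g \<Rightarrow> ('o \<Rightarrow> 'g)" where
  "colim_in C F x a = (\<lambda>y\<in>Obj C. if y = x then a else \<one>\<^bsub>On_obj F y\<^esub>)"

definition colim_rel :: "('o, 'a) cat \<Rightarrow> ('o, 'a, 'g) abfun \<Rightarrow> ('o \<Rightarrow> 'g) set" where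
  "colim_rel C F = generate (sum_group (Obj C) (On_obj F))
     {colim_in C F (Cod C f) (On_arr F f a)
        \<otimes>\<^bsub>sum_group (Obj C) (On_obj F)\<^esub> inv\<^bsub>sum_group (Obj C) (On_obj F)\<^esub> colim_in C F (Dom C f) a
      | f a. f \<in> Arr C \<and> a \<in> carrier (On_obj F (Dom C f))}"

definition colim :: "('o, 'a) cat \<Rightarrow> ('o, 'a, 'g) abfun \<Rightarrow> ('o \<Rightarrow> 'g) set monoid" where
  "colim C F = sum_group (Obj C) (On_obj F) Mod colim_rel C F"

definition colim_map ::
  "('o, 'a) cat \<Rightarrow> ('o, 'a, 'h) abfun \<Rightarrow> ('o \<Rightarrow> 'g \<Rightarrow> 'h) \<Rightarrow> ('o \<Rightarrow> 'g) set \<Rightarrow> ('o \<Rightarrow> 'h) set" where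
  "colim_map C G \<eta> A =
     (\<Union>s\<in>A. colim_rel C G #>\<^bsub>sum_group (Obj C) (On_obj G)\<^esub> (\<lambda>x\<in>Obj C. \<eta> x (s x)))"

text \<open>The canonical maps \<open>F x \<rightarrow> colim F\<close>. Theorems \<open>colim_universal\<close>, \<open>colim_hom_eqI\<close> and
  \<open>colim_map_hom_inj\<close> confirm that \<open>colim\<close> has the universal property and that \<open>colim_map\<close> is the
  induced map.\<close>

definition colim_inj :: "('o, 'a) cat \<Rightarrow> ('o, 'a, 'g) abfun \<Rightarrow> 'o \<Rightarrow> 'g \<Rightarrow> ('o \<Rightarrow> 'g) set" where
  "colim_inj C F x a = colim_rel C F #>\<^bsub>sum_group (Obj C) (On_obj F)\<^esub> colim_in C F x a"

locale ab_diagram = small_category C + ab_functor C F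
  for C :: "('o, 'a) cat" and F :: "('o, 'a, 'g) abfun"
begin

abbreviation "DS \<equiv> sum_group (Obj C) (On_obj F)"

lemma On_obj_group: "x \<in> Obj C \<Longrightarrow> group (On_obj F x)"
  by (simp add: On_obj_comm_group comm_group.axioms(2))

lemma carrier_DS: "carrier DS = {s \<in> \<Pi>\<^sub>E x\<in>Obj C. carrier (On_obj F x). finite {x \<in> Obj C. s x \<noteq> \<one>\<^bsub>On_obj F x\<^esub>}}"
  by (rule carrier_sum_group) (rule On_obj_group)

lemma comm_group_DS: "comm_group DS"
proof (rule group.group_comm_groupI)
  show "group DS" by (rule sum_group) (rule On_obj_group)
  fix s t assume "s \<in> carrier DS" "t \<in> carrier DS"
  then show "s \<otimes>\<^bsub>DS\<^esub> t = t \<otimes>\<^bsub>DS\<^esub> s"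
    by (auto simp: carrier_DS PiE_iff intro!: restrict_ext comm_monoid.m_comm comm_group.axioms(1)
        On_obj_comm_group)
qed

lemma colim_in_hom:
  assumes "x \<in> Obj C"
  shows "colim_in C F x \<in> hom (On_obj F x) DS"
proof (rule homI)
  note one = group.is_monoid[OF On_obj_group, THEN monoid.one_closed]
  fix a assume a: "a \<in> carrier (On_obj F x)"
  have "{y \<in> Obj C. colim_in C F x a y \<noteq> \<one>\<^bsub>On_obj F y\<^esub>} \<subseteq> {x}"
    by (auto simp: colim_in_def)
  then have "finite {y \<in> Obj C. colim_in C F x a y \<noteq> \<one>\<^bsub>On_obj F y\<^esub>}"
    using finite_subset by blast
  then show "colim_in C F x a \<in> carrier DS"
    using a one by (auto simp: carrier_DS colim_in_def)
  fix b assume "b \<in> carrier (On_obj F x)"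
  show "colim_in C F x (a \<otimes>\<^bsub>On_obj F x\<^esub> b) = colim_in C F x a \<otimes>\<^bsub>DS\<^esub> colim_in C F x b"
    using one by (auto simp: colim_in_def fun_eq_iff On_obj_group group.is_monoid monoid.l_one)
qed

lemma colim_rel_subgroup: "subgroup (colim_rel C F) DS"
proof -
  interpret DS: comm_group DS by (rule comm_group_DS)
  show ?thesis
    unfolding colim_rel_def
  proof (rule DS.generate_is_subgroup, clarify)
    fix f a assume f: "f \<in> Arr C" and a: "a \<in> carrier (On_obj F (Dom C f))"
    have "colim_in C F (Cod C f) (On_arr F f a) \<in> carrier DS"
      by (rule hom_in_carrier[OF colim_in_hom[OF Cod_in[OF f]]])
        (rule hom_in_carrier[OF On_arr_hom[OF f] a])
    moreover have "colim_in C F (Dom C f) a \<in> carrier DS"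
      by (rule hom_in_carrier[OF colim_in_hom[OF Dom_in[OF f]] a])
    ultimately show "colim_in C F (Cod C f) (On_arr F f a) \<otimes>\<^bsub>DS\<^esub> inv\<^bsub>DS\<^esub> colim_in C F (Dom C f) a \<in> carrier DS"
      by (simp del: mult_sum_group)
  qed
qed

lemma colim_rel_normal: "colim_rel C F \<lhd> DS"
  by (rule comm_group.subgroup_imp_normal[OF comm_group_DS colim_rel_subgroup])

lemma comm_group_colim: "comm_group (colim C F)"
  unfolding colim_def by (rule comm_group.abelian_FactGroup[OF comm_group_DS colim_rel_subgroup])

lemma colim_inj_hom:
  assumes "x \<in> Obj C"
  shows "colim_inj C F x \<in> hom (On_obj F x) (colim C F)"
proof -
  have "(\<lambda>s. colim_rel C F #>\<^bsub>DS\<^esub> s) \<in> hom DS (colim C F)"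
    unfolding colim_def by (rule normal.r_coset_hom_Mod[OF colim_rel_normal])
  from hom_compose[OF colim_in_hom[OF assms] this] show ?thesis
    by (simp add: colim_inj_def[abs_def] comp_def)
qed

lemma colim_inj_cocone:
  assumes f: "f \<in> Arr C" and a: "a \<in> carrier (On_obj F (Dom C f))"
  shows "colim_inj C F (Cod C f) (On_arr F f a) = colim_inj C F (Dom C f) a"
proof -
  interpret DS: comm_group DS by (rule comm_group_DS)
  have 1: "colim_in C F (Cod C f) (On_arr F f a) \<in> carrier DS" (is "?u \<in> _")
    by (rule hom_in_carrier[OF colim_in_hom[OF Cod_in[OF f]]])
      (rule hom_in_carrier[OF On_arr_hom[OF f] a])
  have 2: "colim_in C F (Dom C f) a \<in> carrier DS" (is "?v \<in> _")
    by (rule hom_in_carrier[OF colim_in_hom[OF Dom_in[OF f]] a])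
  have "?u \<otimes>\<^bsub>DS\<^esub> inv\<^bsub>DS\<^esub> ?v \<in> colim_rel C F"
    unfolding colim_rel_def using f a by (intro generate.incl) blast
  then have "?u \<in> colim_rel C F #>\<^bsub>DS\<^esub> ?v"
    using DS.rcosI[of "?u \<otimes>\<^bsub>DS\<^esub> inv\<^bsub>DS\<^esub> ?v" "colim_rel C F" ?v]
      subgroup.subset[OF colim_rel_subgroup] 1 2
    by (simp add: DS.m_assoc del: mult_sum_group one_sum_group)
  from DS.repr_independence[OF this 2 colim_rel_subgroup] show ?thesis
    by (simp add: colim_inj_def)
qed

lemma DS_hom_eqI:
  assumes h: "h \<in> hom DS A" and k: "k \<in> hom DS A" and A: "group A"
    and eq: "\<And>x a. \<lbrakk>x \<in> Obj C; a \<in> carrier (On_obj F x)\<rbrakk> \<Longrightarrow>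
      h (colim_in C F x a) = k (colim_in C F x a)"
    and s: "s \<in> carrier DS"
  shows "h s = k s"
proof -
  interpret DS: comm_group DS by (rule comm_group_DS)
  have hk1: "h \<one>\<^bsub>DS\<^esub> = k \<one>\<^bsub>DS\<^esub>"
    using hom_one[OF h DS.is_group A] hom_one[OF k DS.is_group A] by simp
  have fin: "finite T \<Longrightarrow> \<forall>s\<in>carrier DS. {x \<in> Obj C. s x \<noteq> \<one>\<^bsub>On_obj F x\<^esub>} = T \<longrightarrow> h s = k s" for T
  proof (induction T rule: finite_induct)
    case empty
    show ?case
    proof (intro ballI impI)
      fix s assume "s \<in> carrier DS" "{x \<in> Obj C. s x \<noteq> \<one>\<^bsub>On_obj F x\<^esub>} = {}"
      then have "s = \<one>\<^bsub>DS\<^esub>" by (auto simp: carrier_DS PiE_def extensional_def fun_eq_iff)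
      with hk1 show "h s = k s" by simp
    qed
  next
    case (insert y T)
    show ?case
    proof (intro ballI impI)
      fix s assume s: "s \<in> carrier DS" "{x \<in> Obj C. s x \<noteq> \<one>\<^bsub>On_obj F x\<^esub>} = insert y T"
      then have y: "y \<in> Obj C" "s y \<in> carrier (On_obj F y)" by (auto simp: carrier_DS)
      define t where "t = (\<lambda>x\<in>Obj C. if x = y then \<one>\<^bsub>On_obj F x\<^esub> else s x)"
      have tT: "{x \<in> Obj C. t x \<noteq> \<one>\<^bsub>On_obj F x\<^esub>} = T"
        using s(2) insert(2) by (auto simp: t_def)
      have t: "t \<in> carrier DS"
        using s(1) insert(1) tT
        by (auto simp: carrier_DS t_def On_obj_group group.is_monoid monoid.one_closed)
      have u: "colim_in C F y (s y) \<in> carrier DS"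
        by (rule hom_in_carrier[OF colim_in_hom[OF y(1)] y(2)])
      have sx: "s x \<in> carrier (On_obj F x)" if "x \<in> Obj C" for x
        using s(1) that by (auto simp: carrier_DS)
      have st: "s = t \<otimes>\<^bsub>DS\<^esub> colim_in C F y (s y)"
      proof
        fix x show "s x = (t \<otimes>\<^bsub>DS\<^esub> colim_in C F y (s y)) x"
          using s(1) sx[of x] y
          by (cases "x \<in> Obj C") (auto simp: t_def colim_in_def carrier_DS PiE_def extensional_def
              On_obj_group group.is_monoid monoid.l_one monoid.r_one)
      qed
      have ht: "h t = k t" using insert(3) t tT by simp
      have "h s = h (t \<otimes>\<^bsub>DS\<^esub> colim_in C F y (s y))" by (rule arg_cong[OF st])
      also have "\<dots> = k (t \<otimes>\<^bsub>DS\<^esub> colim_in C F y (s y))"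
        unfolding hom_mult[OF h t u] hom_mult[OF k t u] ht eq[OF y] ..
      also have "\<dots> = k s" by (rule arg_cong[OF st[symmetric]])
      finally show "h s = k s" .
    qed
  qed
  have "finite {x \<in> Obj C. s x \<noteq> \<one>\<^bsub>On_obj F x\<^esub>}"
    using s unfolding carrier_DS by blast
  from fin[OF this] s show ?thesis by blast
qed

theorem colim_universal:
  assumes A: "comm_group A"
    and \<tau>: "\<And>x. x \<in> Obj C \<Longrightarrow> \<tau> x \<in> hom (On_obj F x) A"
    and \<tau>_cocone: "\<And>f a. \<lbrakk>f \<in> Arr C; a \<in> carrier (On_obj F (Dom C f))\<rbrakk> \<Longrightarrow>
      \<tau> (Cod C f) (On_arr F f a) = \<tau> (Dom C f) a"
  obtains h where "h \<in> hom (colim C F) A"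
    and "\<And>x a. \<lbrakk>x \<in> Obj C; a \<in> carrier (On_obj F x)\<rbrakk> \<Longrightarrow> h (colim_inj C F x a) = \<tau> x a"
proof -
  interpret DS: comm_group DS by (rule comm_group_DS)
  interpret A: comm_group A by (rule A)
  define H where "H s = gfinprod A (\<lambda>x. \<tau> x (s x)) (Obj C)" for s
  have H: "H \<in> hom DS A"
    unfolding H_def[abs_def] by (rule A.hom_group_sum) (use \<tau> On_obj_group in auto)
  interpret H: group_hom DS A H
    by (simp add: group_hom_def group_hom_axioms_def H DS.is_group)
  have H_in: "H (colim_in C F x a) = \<tau> x a" if x: "x \<in> Obj C" and a: "a \<in> carrier (On_obj F x)" for x a
  proof -
    have \<tau>1: "\<tau> y \<one>\<^bsub>On_obj F y\<^esub> = \<one>\<^bsub>A\<^esub>" if "y \<in> Obj C" for y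
      using hom_one[OF \<tau>[OF that] On_obj_group[OF that]] by simp
    have \<tau>a: "\<tau> x a \<in> carrier A" by (rule hom_in_carrier[OF \<tau>[OF x] a])
    have "H (colim_in C F x a) = gfinprod A (\<lambda>y. if y = x then \<tau> x a else \<one>\<^bsub>A\<^esub>) (Obj C)"
      unfolding H_def by (rule A.gfinprod_cong) (auto simp: colim_in_def \<tau>1 \<tau>a simp_implies_def)
    also have "\<dots> = gfinprod A (\<lambda>y. if y = x then \<tau> x a else \<one>\<^bsub>A\<^esub>) {x}"
      by (rule A.gfinprod_mono_neutral_cong_right) (use x \<tau>a in auto)
    also have "\<dots> = \<tau> x a" using \<tau>a by simp
    finally show ?thesis .
  qed
  have ker: "colim_rel C F \<subseteq> kernel DS A H"
    unfolding colim_rel_def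
  proof (rule DS.generate_subgroup_incl[OF _ H.subgroup_kernel], clarify)
    fix f a assume f: "f \<in> Arr C" and a: "a \<in> carrier (On_obj F (Dom C f))"
    have fa: "On_arr F f a \<in> carrier (On_obj F (Cod C f))"
      by (rule hom_in_carrier[OF On_arr_hom[OF f] a])
    note u = hom_in_carrier[OF colim_in_hom[OF Cod_in[OF f]] fa]
    note v = hom_in_carrier[OF colim_in_hom[OF Dom_in[OF f]] a]
    note ta = hom_in_carrier[OF \<tau>[OF Dom_in[OF f]] a]
    show "colim_in C F (Cod C f) (On_arr F f a) \<otimes>\<^bsub>DS\<^esub> inv\<^bsub>DS\<^esub> colim_in C F (Dom C f) a \<in> kernel DS A H"
      using u v ta
      by (simp add: kernel_def H_in[OF Cod_in[OF f] fa] H_in[OF Dom_in[OF f] a] \<tau>_cocone[OF f a]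
          del: mult_sum_group)
  qed
  have const: "H s = H t"
    if s: "s \<in> carrier DS" and t: "t \<in> carrier DS"
      and st: "colim_rel C F #>\<^bsub>DS\<^esub> s = colim_rel C F #>\<^bsub>DS\<^esub> t" for s t
  proof -
    have "s \<in> colim_rel C F #>\<^bsub>DS\<^esub> t"
      using DS.rcos_self[OF s colim_rel_subgroup] st by simp
    then obtain r where r: "r \<in> colim_rel C F" "s = r \<otimes>\<^bsub>DS\<^esub> t" by (auto simp: r_coset_def)
    then have "r \<in> carrier DS" "H r = \<one>\<^bsub>A\<^esub>" using ker by (auto simp: kernel_def)
    with r t show ?thesis by (simp del: mult_sum_group)
  qed
  obtain g where g: "g \<in> hom (DS Mod colim_rel C F) A"
    "\<And>s. s \<in> carrier DS \<Longrightarrow> g (colim_rel C F #>\<^bsub>DS\<^esub> s) = H s"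
    using FactGroup_universal[OF H colim_rel_normal const] by blast
  show thesis
  proof
    show "g \<in> hom (colim C F) A" using g(1) by (simp add: colim_def)
    fix x a assume "x \<in> Obj C" "a \<in> carrier (On_obj F x)"
    then show "g (colim_inj C F x a) = \<tau> x a"
      using g(2)[OF hom_in_carrier[OF colim_in_hom]] H_in by (simp add: colim_inj_def)
  qed
qed

theorem colim_hom_eqI:
  assumes h: "h \<in> hom (colim C F) A" and k: "k \<in> hom (colim C F) A" and A: "group A"
    and eq: "\<And>x a. \<lbrakk>x \<in> Obj C; a \<in> carrier (On_obj F x)\<rbrakk> \<Longrightarrow>
      h (colim_inj C F x a) = k (colim_inj C F x a)"
    and c: "c \<in> carrier (colim C F)"
  shows "h c = k c"
proof -
  have p: "(\<lambda>s. colim_rel C F #>\<^bsub>DS\<^esub> s) \<in> hom DS (colim C F)"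
    unfolding colim_def by (rule normal.r_coset_hom_Mod[OF colim_rel_normal])
  from c obtain s where s: "s \<in> carrier DS" "c = colim_rel C F #>\<^bsub>DS\<^esub> s"
    by (auto simp: colim_def FactGroup_def RCOSETS_def)
  have "(h \<circ> (\<lambda>s. colim_rel C F #>\<^bsub>DS\<^esub> s)) s = (k \<circ> (\<lambda>s. colim_rel C F #>\<^bsub>DS\<^esub> s)) s"
    by (rule DS_hom_eqI[OF hom_compose[OF p h] hom_compose[OF p k] A _ s(1)])
      (use eq in \<open>simp add: colim_inj_def\<close>)
  with s show ?thesis by simp
qed

end

theorem colim_map_hom_inj:
  assumes "ab_diagram C F" "ab_diagram C G" and \<eta>: "nat_trans C F G \<eta>"
  shows "colim_map C G \<eta> \<in> hom (colim C F) (colim C G)"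
    and "\<And>x a. \<lbrakk>x \<in> Obj C; a \<in> carrier (On_obj F x)\<rbrakk> \<Longrightarrow>
      colim_map C G \<eta> (colim_inj C F x a) = colim_inj C G x (\<eta> x a)"
proof -
  interpret F: ab_diagram C F by fact
  interpret G: ab_diagram C G by fact
  interpret DF: comm_group F.DS by (rule F.comm_group_DS)
  interpret DG: comm_group G.DS by (rule G.comm_group_DS)
  have \<eta>_hom: "\<eta> x \<in> hom (On_obj F x) (On_obj G x)" if "x \<in> Obj C" for x
    using \<eta> that by (simp add: nat_trans_def)
  have \<eta>1: "\<eta> x \<one>\<^bsub>On_obj F x\<^esub> = \<one>\<^bsub>On_obj G x\<^esub>" if "x \<in> Obj C" for x
    by (rule hom_one[OF \<eta>_hom[OF that] F.On_obj_group[OF that] G.On_obj_group[OF that]])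
  define E where "E s = (\<lambda>x\<in>Obj C. \<eta> x (s x))" for s
  have E: "E \<in> hom F.DS G.DS"
  proof (rule homI)
    fix s assume s: "s \<in> carrier F.DS"
    then have "{x \<in> Obj C. E s x \<noteq> \<one>\<^bsub>On_obj G x\<^esub>} \<subseteq> {x \<in> Obj C. s x \<noteq> \<one>\<^bsub>On_obj F x\<^esub>}"
      by (auto simp: E_def \<eta>1)
    then have "finite {x \<in> Obj C. E s x \<noteq> \<one>\<^bsub>On_obj G x\<^esub>}"
      using s finite_subset by (auto simp: F.carrier_DS)
    then show "E s \<in> carrier G.DS"
      using s by (auto simp: F.carrier_DS G.carrier_DS E_def PiE_iff hom_in_carrier[OF \<eta>_hom])
    fix t assume t: "t \<in> carrier F.DS"
    show "E (s \<otimes>\<^bsub>F.DS\<^esub> t) = E s \<otimes>\<^bsub>G.DS\<^esub> E t"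
      using s t by (auto simp: E_def F.carrier_DS PiE_iff hom_mult[OF \<eta>_hom] intro!: restrict_ext)
  qed
  interpret E: group_hom F.DS G.DS E
    by (simp add: group_hom_def group_hom_axioms_def E DF.is_group DG.is_group)
  have E_in: "E (colim_in C F x a) = colim_in C G x (\<eta> x a)" if "x \<in> Obj C" for x a
    using that by (auto simp: E_def colim_in_def \<eta>1)
  obtain h where h: "h \<in> hom (colim C F) (colim C G)"
    and h_inj: "\<And>x a. \<lbrakk>x \<in> Obj C; a \<in> carrier (On_obj F x)\<rbrakk> \<Longrightarrow>
      h (colim_inj C F x a) = colim_inj C G x (\<eta> x a)"
  proof (rule F.colim_universal[OF G.comm_group_colim, of "\<lambda>x a. colim_inj C G x (\<eta> x a)"])
    fix x assume x: "x \<in> Obj C"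
    show "(\<lambda>a. colim_inj C G x (\<eta> x a)) \<in> hom (On_obj F x) (colim C G)"
      using hom_compose[OF \<eta>_hom[OF x] G.colim_inj_hom[OF x]] by (simp add: comp_def)
  next
    fix f a assume f: "f \<in> Arr C" and a: "a \<in> carrier (On_obj F (Dom C f))"
    show "colim_inj C G (Cod C f) (\<eta> (Cod C f) (On_arr F f a)) = colim_inj C G (Dom C f) (\<eta> (Dom C f) a)"
      using \<eta> f a G.colim_inj_cocone[OF f hom_in_carrier[OF \<eta>_hom[OF F.Dom_in[OF f]] a]]
      by (simp add: nat_trans_def)
  qed blast
  have pF: "(\<lambda>s. colim_rel C F #>\<^bsub>F.DS\<^esub> s) \<in> hom F.DS (colim C F)"
    unfolding colim_def by (rule normal.r_coset_hom_Mod[OF F.colim_rel_normal])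
  have pG: "(\<lambda>s. colim_rel C G #>\<^bsub>G.DS\<^esub> s) \<in> hom G.DS (colim C G)"
    unfolding colim_def by (rule normal.r_coset_hom_Mod[OF G.colim_rel_normal])
  have hE: "h (colim_rel C F #>\<^bsub>F.DS\<^esub> s) = colim_rel C G #>\<^bsub>G.DS\<^esub> E s" if s: "s \<in> carrier F.DS" for s
  proof -
    have "(h \<circ> (\<lambda>s. colim_rel C F #>\<^bsub>F.DS\<^esub> s)) s = ((\<lambda>s. colim_rel C G #>\<^bsub>G.DS\<^esub> s) \<circ> E) s"
      by (rule F.DS_hom_eqI[OF hom_compose[OF pF h] hom_compose[OF E pG]
            comm_group.axioms(2)[OF G.comm_group_colim] _ s])
        (use h_inj in \<open>simp add: colim_inj_def E_in\<close>)
    then show ?thesis by simp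
  qed
  have map_h: "colim_map C G \<eta> A = h A" if A: "A \<in> carrier (colim C F)" for A
  proof -
    from A obtain s where s: "s \<in> carrier F.DS" "A = colim_rel C F #>\<^bsub>F.DS\<^esub> s"
      by (auto simp: colim_def FactGroup_def RCOSETS_def)
    have "colim_rel C G #>\<^bsub>G.DS\<^esub> E t = h A" if t: "t \<in> A" for t
    proof -
      have tD: "t \<in> carrier F.DS"
        using t s DF.r_coset_subset_G[OF subgroup.subset[OF F.colim_rel_subgroup]] by blast
      have "colim_rel C F #>\<^bsub>F.DS\<^esub> t = A"
        using DF.repr_independence[OF _ s(1) F.colim_rel_subgroup] t s(2) by simp
      with hE[OF tD] show ?thesis by simp
    qed
    moreover have "s \<in> A" using DF.rcos_self[OF s(1) F.colim_rel_subgroup] s(2) by simp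
    ultimately show ?thesis by (auto simp: colim_map_def E_def)
  qed
  show "colim_map C G \<eta> \<in> hom (colim C F) (colim C G)"
  proof (rule homI)
    fix A B assume AB: "A \<in> carrier (colim C F)" "B \<in> carrier (colim C F)"
    show "colim_map C G \<eta> A \<in> carrier (colim C G)"
      using AB map_h hom_in_carrier[OF h] by simp
    have "A \<otimes>\<^bsub>colim C F\<^esub> B \<in> carrier (colim C F)"
      using AB F.comm_group_colim by (simp add: comm_group_def comm_monoid_def monoid.m_closed)
    then show "colim_map C G \<eta> (A \<otimes>\<^bsub>colim C F\<^esub> B) = colim_map C G \<eta> A \<otimes>\<^bsub>colim C G\<^esub> colim_map C G \<eta> B"
      using AB map_h hom_mult[OF h] by simp
  qed
  fix x a assume xa: "x \<in> Obj C" "a \<in> carrier (On_obj F x)"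
  then show "colim_map C G \<eta> (colim_inj C F x a) = colim_inj C G x (\<eta> x a)"
    using map_h[OF hom_in_carrier[OF F.colim_inj_hom[OF xa(1)] xa(2)]] h_inj by simp
qed


section \<open>Derived functors of the colimit\<close>

text \<open>The type argument lists the element types of the two functors \<open>F\<close> and \<open>G\<close> over which the
  lifting problems range.\<close>

definition projective ::
  "('o, 'a) cat \<Rightarrow> ('o, 'a, 'p) abfun \<Rightarrow> ('g \<times> 'h) itself \<Rightarrow> bool" where
  "projective C P (T :: ('g \<times> 'h) itself) \<longleftrightarrow> ab_functor C P \<and>
     (\<forall>(F :: ('o, 'a, 'g) abfun) (G :: ('o, 'a, 'h) abfun) \<eta> \<alpha>.
        ab_functor C F \<and> ab_functor C G \<and> nat_trans C F G \<eta> \<and>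
        (\<forall>x\<in>Obj C. \<eta> x ` carrier (On_obj F x) = carrier (On_obj G x)) \<and> nat_trans C P G \<alpha> \<longrightarrow>
        (\<exists>\<beta>. nat_trans C P F \<beta> \<and>
           (\<forall>x\<in>Obj C. \<forall>a\<in>carrier (On_obj P x). \<eta> x (\<beta> x a) = \<alpha> x a)))"

text \<open>The sequence \<open>\<dots> \<rightarrow> P 1 \<rightarrow> P 0 \<rightarrow> F \<rightarrow> 0\<close> with maps \<open>d n : P (n + 1) \<rightarrow> P n\<close> and
  \<open>\<epsilon> : P 0 \<rightarrow> F\<close> is exact and all \<open>P n\<close> are projective.\<close>

definition projective_resolution ::
  "('o, 'a) cat \<Rightarrow> ('o, 'a, 'f) abfun \<Rightarrow> (nat \<Rightarrow> ('o, 'a, 'p) abfun) \<Rightarrow>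
   (nat \<Rightarrow> 'o \<Rightarrow> 'p \<Rightarrow> 'p) \<Rightarrow> ('o \<Rightarrow> 'p \<Rightarrow> 'f) \<Rightarrow> ('g \<times> 'h) itself \<Rightarrow> bool" where
  "projective_resolution C F P d \<epsilon> T \<longleftrightarrow>
     (\<forall>n. projective C (P n) T) \<and>
     (\<forall>n. nat_trans C (P (Suc n)) (P n) (d n)) \<and>
     nat_trans C (P 0) F \<epsilon> \<and>
     (\<forall>x\<in>Obj C. \<epsilon> x ` carrier (On_obj (P 0) x) = carrier (On_obj F x)) \<and>
     (\<forall>x\<in>Obj C. d 0 x ` carrier (On_obj (P 1) x) = kernel (On_obj (P 0) x) (On_obj F x) (\<epsilon> x)) \<and>
     (\<forall>n. \<forall>x\<in>Obj C. d (Suc n) x ` carrier (On_obj (P (Suc (Suc n))) x) =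
        kernel (On_obj (P (Suc n)) x) (On_obj (P n) x) (d n x))"

text \<open>The homology in degree \<open>k\<close> of the chain complex obtained by applying the colimit functor to
  \<open>\<dots> \<rightarrow> P 1 \<rightarrow> P 0 \<rightarrow> 0\<close>.\<close>

definition colim_cycles ::
  "('o, 'a) cat \<Rightarrow> (nat \<Rightarrow> ('o, 'a, 'p) abfun) \<Rightarrow> (nat \<Rightarrow> 'o \<Rightarrow> 'p \<Rightarrow> 'p) \<Rightarrow> nat \<Rightarrow>
   ('o \<Rightarrow> 'p) set set" where
  "colim_cycles C P d k = (case k of
      0 \<Rightarrow> carrier (colim C (P 0))
    | Suc j \<Rightarrow> kernel (colim C (P (Suc j))) (colim C (P j)) (colim_map C (P j) (d j)))"

definition colim_homology ::
  "('o, 'a) cat \<Rightarrow> (nat \<Rightarrow> ('o, 'a, 'p) abfun) \<Rightarrow> (nat \<Rightarrow> 'o \<Rightarrow> 'p \<Rightarrow> 'p) \<Rightarrow> nat \<Rightarrow>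
   ('o \<Rightarrow> 'p) set set monoid" where
  "colim_homology C P d k =
     (colim C (P k))\<lparr>carrier := colim_cycles C P d k\<rparr>
       Mod (colim_map C (P k) (d k) ` carrier (colim C (P (Suc k))))"

text \<open>The standard (bar) resolution of the constant functor. The group \<open>bar C n x\<close> is the direct sum
  of the groups \<open>\<int>[C(c\<^sub>n, x)]\<close> over all sequences \<open>c\<^sub>0 \<rightarrow> \<dots> \<rightarrow> c\<^sub>n\<close> of \<open>n\<close> composable
  arrows; a basis element is a list of \<open>n + 1\<close> composable arrows \<open>c\<^sub>0 \<rightarrow> \<dots> \<rightarrow> c\<^sub>n \<rightarrow> x\<close>.\<close>

definition bar_chains :: "('o, 'a) cat \<Rightarrow> nat \<Rightarrow> 'o \<Rightarrow> 'a list set" where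
  "bar_chains C n x = {fs. length fs = Suc n \<and> set fs \<subseteq> Arr C \<and>
     (\<forall>i<n. Cod C (fs ! i) = Dom C (fs ! Suc i)) \<and> Cod C (last fs) = x}"

definition bar_push :: "('o, 'a) cat \<Rightarrow> 'a \<Rightarrow> 'a list \<Rightarrow> 'a list" where
  "bar_push C f fs = butlast fs @ [Comp C (last fs) f]"

definition bar :: "('o, 'a) cat \<Rightarrow> nat \<Rightarrow> ('o, 'a, 'a list \<Rightarrow>\<^sub>0 int) abfun" where
  "bar C n = \<lparr>On_obj = (\<lambda>x. free_Abelian_group (bar_chains C n x)),
              On_arr = (\<lambda>f. frag_extend (\<lambda>fs. frag_of (bar_push C f fs)))\<rparr>"

text \<open>The \<open>i\<close>-th face omits the object \<open>c\<^sub>i\<close>.\<close>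

definition bar_face :: "('o, 'a) cat \<Rightarrow> nat \<Rightarrow> 'a list \<Rightarrow> 'a list" where
  "bar_face C i fs = (case i of
      0 \<Rightarrow> tl fs
    | Suc j \<Rightarrow> take j fs @ Comp C (fs ! j) (fs ! Suc j) # drop (Suc (Suc j)) fs)"

definition bar_boundary ::
  "('o, 'a) cat \<Rightarrow> nat \<Rightarrow> 'o \<Rightarrow> ('a list \<Rightarrow>\<^sub>0 int) \<Rightarrow> ('a list \<Rightarrow>\<^sub>0 int)" where
  "bar_boundary C n x =
     frag_extend (\<lambda>fs. \<Sum>i\<le>Suc n. frag_cmul ((-1) ^ i) (frag_of (bar_face C i fs)))"

definition bar_aug :: "'o \<Rightarrow> ('a list \<Rightarrow>\<^sub>0 int) \<Rightarrow> int" where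
  "bar_aug x c = (\<Sum>fs\<in>Poly_Mapping.keys c. Poly_Mapping.lookup c fs)"

lemma hom_free_Abelian_group_eqI:
  assumes "h \<in> hom (free_Abelian_group S) G" "k \<in> hom (free_Abelian_group S) G" "group G"
    and eq: "\<And>s. s \<in> S \<Longrightarrow> h (frag_of s) = k (frag_of s)"
    and c: "Poly_Mapping.keys c \<subseteq> S"
  shows "h c = k c"
proof -
  interpret h: group_hom "free_Abelian_group S" G h
    using assms by (simp add: group_hom_def group_hom_axioms_def)
  interpret k: group_hom "free_Abelian_group S" G k
    using assms by (simp add: group_hom_def group_hom_axioms_def)
  have hdiff: "l (a - b) = l a \<otimes>\<^bsub>G\<^esub> inv\<^bsub>G\<^esub> l b"
    if "group_hom (free_Abelian_group S) G l" "Poly_Mapping.keys a \<subseteq> S" "Poly_Mapping.keys b \<subseteq> S" for l a b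
    using group_hom.hom_mult[OF that(1), of a "- b"] group_hom.hom_inv[OF that(1), of b] that(2,3)
    by simp
  have "Poly_Mapping.keys c \<subseteq> S \<and> h c = k c"
    using c
  proof (induction rule: frag_induction)
    case zero
    show ?case using h.hom_one k.hom_one by simp
  next
    case (one s)
    then show ?case by (simp add: eq)
  next
    case (diff a b)
    then show ?case
      using keys_diff[of a b] hdiff[OF h.group_hom_axioms, of a b]
        hdiff[OF k.group_hom_axioms, of a b] by auto
  qed
  then show ?thesis by simp
qed

lemma hom_frag_extend:
  assumes "\<And>s. s \<in> S \<Longrightarrow> Poly_Mapping.keys (f s) \<subseteq> T"
  shows "frag_extend f \<in> hom (free_Abelian_group S) (free_Abelian_group T)"
proof (rule homI)
  fix c assume "c \<in> carrier (free_Abelian_group S)"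
  then show "frag_extend f c \<in> carrier (free_Abelian_group T)"
    using keys_frag_extend[of f c] assms by force
qed (simp add: frag_extend_add)

lemma bar_aug_eq:
  assumes "finite A" "Poly_Mapping.keys c \<subseteq> A"
  shows "bar_aug x c = (\<Sum>fs\<in>A. Poly_Mapping.lookup c fs)"
  unfolding bar_aug_def
  by (rule sum.mono_neutral_left) (use assms in \<open>auto simp: in_keys_iff\<close>)

lemma bar_aug_add: "bar_aug x (a + b) = bar_aug x a + bar_aug x b"
proof -
  let ?A = "Poly_Mapping.keys a \<union> Poly_Mapping.keys b"
  have "bar_aug x c = (\<Sum>fs\<in>?A. Poly_Mapping.lookup c fs)" if "Poly_Mapping.keys c \<subseteq> ?A" for c
    by (rule bar_aug_eq) (use that in auto)
  then show ?thesis
    using keys_add[of a b] by (simp add: lookup_add sum.distrib)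
qed

lemma bar_aug_of [simp]: "bar_aug x (frag_of fs) = 1"
  by (simp add: bar_aug_def)

lemma bar_aug_0 [simp]: "bar_aug x 0 = 0"
  by (simp add: bar_aug_def)

lemma bar_aug_uminus: "bar_aug x (- a) = - bar_aug x a"
  using bar_aug_add[of x a "- a"] by simp

lemma bar_aug_diff: "bar_aug x (a - b) = bar_aug x a - bar_aug x b"
  using bar_aug_add[of x a "- b"] by (simp add: bar_aug_uminus)

lemma bar_aug_hom: "bar_aug x \<in> hom (free_Abelian_group S) integer_group"
  by (rule homI) (simp_all add: bar_aug_add integer_group_def)

lemma On_obj_bar [simp]: "On_obj (bar C n) x = free_Abelian_group (bar_chains C n x)"
  by (simp add: bar_def)

lemma On_arr_bar: "On_arr (bar C n) f = frag_extend (\<lambda>fs. frag_of (bar_push C f fs))"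
  by (simp add: bar_def)

lemma bar_push_snoc [simp]: "bar_push C f (gs @ [g]) = gs @ [Comp C g f]"
  by (simp add: bar_push_def)

lemma bar_chains_0: "bar_chains C 0 x = {[f] | f. f \<in> Arr C \<and> Cod C f = x}"
  by (auto simp: bar_chains_def length_Suc_conv)

lemma bar_chains_snoc:
  "gs @ [g] \<in> bar_chains C (Suc n) x \<longleftrightarrow> gs \<in> bar_chains C n (Dom C g) \<and> g \<in> Arr C \<and> Cod C g = x"
proof (cases "length gs = Suc n")
  case True
  have "(\<forall>i<Suc n. Cod C ((gs @ [g]) ! i) = Dom C ((gs @ [g]) ! Suc i)) \<longleftrightarrow>
      (\<forall>i<n. Cod C (gs ! i) = Dom C (gs ! Suc i)) \<and> Cod C (last gs) = Dom C g"
  proof -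
    have "(gs @ [g]) ! i = gs ! i" "(gs @ [g]) ! Suc i = gs ! Suc i" if "i < n" for i
      using True that by (simp_all add: nth_append)
    moreover have "(gs @ [g]) ! n = last gs" "(gs @ [g]) ! Suc n = g"
      using True last_conv_nth[of gs] length_0_conv[of gs] by (auto simp: nth_append simp del: length_0_conv)
    ultimately show ?thesis by (auto simp: less_Suc_eq)
  qed
  then show ?thesis using True by (auto simp: bar_chains_def)
qed (auto simp: bar_chains_def)

lemma bar_chains_SucE:
  assumes "fs \<in> bar_chains C (Suc n) x"
  obtains gs g where "fs = gs @ [g]" "gs \<in> bar_chains C n (Dom C g)" "g \<in> Arr C" "Cod C g = x"
proof -
  have "fs \<noteq> []" using assms by (auto simp: bar_chains_def)
  then obtain gs g where "fs = gs @ [g]" by (metis append_butlast_last_id)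
  with assms that show ?thesis by (simp add: bar_chains_snoc)
qed

lemma bar_chains_1E:
  assumes "fs \<in> bar_chains C (Suc 0) x"
  obtains f g where "fs = [f, g]" "f \<in> Arr C" "g \<in> Arr C" "Cod C f = Dom C g" "Cod C g = x"
proof -
  from assms obtain gs g where "fs = gs @ [g]" "gs \<in> bar_chains C 0 (Dom C g)" "g \<in> Arr C" "Cod C g = x"
    by (rule bar_chains_SucE)
  with that show ?thesis by (auto simp: bar_chains_0)
qed

lemma bar_chains_2E:
  assumes "fs \<in> bar_chains C (Suc (Suc 0)) x"
  obtains f g h where "fs = [f, g, h]" "f \<in> Arr C" "g \<in> Arr C" "h \<in> Arr C"
    "Cod C f = Dom C g" "Cod C g = Dom C h" "Cod C h = x"
proof -
  from assms obtain gs h where h: "fs = gs @ [h]" "gs \<in> bar_chains C (Suc 0) (Dom C h)" "h \<in> Arr C" "Cod C h = x"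
    by (rule bar_chains_SucE)
  from h(2) obtain f g where "gs = [f, g]" "f \<in> Arr C" "g \<in> Arr C" "Cod C f = Dom C g" "Cod C g = Dom C h"
    by (rule bar_chains_1E)
  with h that show ?thesis by simp
qed

lemma bar_face_snoc_less:
  assumes "i < length gs"
  shows "bar_face C i (gs @ [g]) = bar_face C i gs @ [g]"
  using assms by (cases i) (auto simp: bar_face_def nth_append)

lemma bar_face_snoc_last:
  "gs \<noteq> [] \<Longrightarrow> bar_face C (length gs) (gs @ [g]) = bar_push C g gs"
  by (cases gs rule: rev_cases) (auto simp: bar_face_def nth_append bar_push_def)

definition bar_snoc :: "'a \<Rightarrow> ('a list \<Rightarrow>\<^sub>0 int) \<Rightarrow> ('a list \<Rightarrow>\<^sub>0 int)" where
  "bar_snoc g = frag_extend (\<lambda>gs. frag_of (gs @ [g]))"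

lemma bar_boundary_of:
  "bar_boundary C n x (frag_of fs)
    = (\<Sum>i\<le>Suc n. frag_cmul ((-1) ^ i) (frag_of (bar_face C i fs)))"
  by (simp add: bar_boundary_def)

lemma bar_boundary_snoc_Suc:
  assumes "length gs = Suc (Suc n)"
  shows "bar_boundary C (Suc n) x (frag_of (gs @ [g])) =
    bar_snoc g (bar_boundary C n y (frag_of gs)) + frag_cmul ((-1) ^ n) (frag_of (bar_push C g gs))"
proof -
  have "bar_face C (Suc (Suc n)) (gs @ [g]) = bar_push C g gs"
    using bar_face_snoc_last[of gs C g] assms by force
  moreover have "(\<Sum>i\<le>Suc n. frag_cmul ((-1) ^ i) (frag_of (bar_face C i (gs @ [g]))))
      = bar_snoc g (bar_boundary C n y (frag_of gs))"
    unfolding bar_boundary_of bar_snoc_def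
    by (subst frag_extend_sum) (auto simp: frag_extend_cmul bar_face_snoc_less assms intro!: sum.cong)
  ultimately show ?thesis
    unfolding bar_boundary_of by (subst sum.atMost_Suc) (simp del: sum.atMost_Suc)
qed

lemma bar_boundary_pair:
  "bar_boundary C 0 x (frag_of [f, g]) = frag_of [g] - frag_of [Comp C f g]"
  by (simp add: bar_boundary_of bar_face_def)

context small_category
begin

lemma bar_push_in:
  assumes "fs \<in> bar_chains C n (Dom C f)" "f \<in> Arr C"
  shows "bar_push C f fs \<in> bar_chains C n (Cod C f)"
proof (cases n)
  case 0
  with assms show ?thesis by (auto simp: bar_chains_0 bar_push_def Comp_in Cod_Comp)
next
  case (Suc m)
  with assms show ?thesis
    by (auto elim!: bar_chains_SucE simp: bar_chains_snoc Comp_in Cod_Comp Dom_Comp)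
qed

lemma bar_chains_last:
  assumes "fs \<in> bar_chains C n x"
  obtains gs g where "fs = gs @ [g]" "g \<in> Arr C" "Cod C g = x"
proof (cases n)
  case 0
  with assms that[of "[]"] show ?thesis by (auto simp: bar_chains_0)
next
  case (Suc m)
  with assms that show ?thesis by (auto elim: bar_chains_SucE)
qed

lemma bar_push_Ident: "fs \<in> bar_chains C n x \<Longrightarrow> bar_push C (Ident C x) fs = fs"
  by (auto elim!: bar_chains_last simp: Comp_Ident)

lemma bar_push_Comp:
  assumes "fs \<in> bar_chains C n (Dom C f)" "f \<in> Arr C" "g \<in> Arr C" "Cod C f = Dom C g"
  shows "bar_push C (Comp C f g) fs = bar_push C g (bar_push C f fs)"
  using assms by (auto elim!: bar_chains_last simp: Comp_assoc)

lemma bar_snoc_in: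
  assumes "f \<in> Arr C"
  shows "bar_snoc f \<in> hom (free_Abelian_group (bar_chains C n (Dom C f)))
                         (free_Abelian_group (bar_chains C (Suc n) (Cod C f)))"
  unfolding bar_snoc_def
  by (rule hom_frag_extend) (use assms in \<open>auto simp: bar_chains_snoc\<close>)

lemma On_arr_bar_hom:
  assumes "f \<in> Arr C"
  shows "On_arr (bar C n) f \<in> hom (free_Abelian_group (bar_chains C n (Dom C f)))
                                 (free_Abelian_group (bar_chains C n (Cod C f)))"
  unfolding On_arr_bar
  by (rule hom_frag_extend) (use assms bar_push_in in auto)

lemma ab_functor_bar: "ab_functor C (bar C n)"
proof (rule ab_functor.intro)
  fix x show "comm_group (On_obj (bar C n) x)"
    by (simp add: abelian_free_Abelian_group)
next
  fix f assume "f \<in> Arr C"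
  then show "On_arr (bar C n) f \<in> hom (On_obj (bar C n) (Dom C f)) (On_obj (bar C n) (Cod C f))"
    by (simp add: On_arr_bar_hom)
next
  fix x a assume "x \<in> Obj C" "a \<in> carrier (On_obj (bar C n) x)"
  then have "On_arr (bar C n) (Ident C x) a = frag_extend frag_of a"
    unfolding On_arr_bar by (intro frag_extend_eq) (auto simp: bar_push_Ident)
  then show "On_arr (bar C n) (Ident C x) a = a"
    using frag_expansion[of a] by simp
next
  fix f g a assume fg: "f \<in> Arr C" "g \<in> Arr C" "Cod C f = Dom C g"
    and a: "a \<in> carrier (On_obj (bar C n) (Dom C f))"
  have "On_arr (bar C n) g (On_arr (bar C n) f a) =
      frag_extend (\<lambda>fs. frag_of (bar_push C g (bar_push C f fs))) a"
    unfolding On_arr_bar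
    using frag_extend_compose[of "\<lambda>fs. frag_of (bar_push C g fs)" "bar_push C f" a] by (simp add: o_def)
  also have "\<dots> = On_arr (bar C n) (Comp C f g) a"
    unfolding On_arr_bar
    by (intro frag_extend_eq) (use fg a in \<open>auto simp: bar_push_Comp\<close>)
  finally show "On_arr (bar C n) (Comp C f g) a = On_arr (bar C n) g (On_arr (bar C n) f a)"
    by simp
qed

lemma bar_boundary_of_in:
  "fs \<in> bar_chains C (Suc n) x \<Longrightarrow>
    Poly_Mapping.keys (bar_boundary C n x (frag_of fs)) \<subseteq> bar_chains C n x"
proof (induction n arbitrary: fs x)
  case 0
  then obtain f g where fg: "fs = [f, g]" "f \<in> Arr C" "g \<in> Arr C" "Cod C f = Dom C g" "Cod C g = x"
    by (elim bar_chains_1E)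
  then have "{[g], [Comp C f g]} \<subseteq> bar_chains C 0 x"
    by (auto simp: bar_chains_0 Comp_in Cod_Comp)
  then show ?case
    using keys_diff[of "frag_of [g]" "frag_of [Comp C f g]"] by (auto simp: fg bar_boundary_pair)
next
  case (Suc n)
  from Suc.prems obtain gs g where g: "fs = gs @ [g]" "gs \<in> bar_chains C (Suc n) (Dom C g)"
      "g \<in> Arr C" "Cod C g = x"
    by (rule bar_chains_SucE)
  have len: "length gs = Suc (Suc n)" using g by (simp add: bar_chains_def)
  have "bar_snoc g (bar_boundary C n (Dom C g) (frag_of gs))
      \<in> carrier (free_Abelian_group (bar_chains C (Suc n) (Cod C g)))"
    using hom_in_carrier[OF bar_snoc_in[OF g(3)]] Suc.IH[OF g(2)] by simp
  moreover have "Poly_Mapping.keys (frag_cmul ((-1) ^ n) (frag_of (bar_push C g gs)))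
      \<subseteq> bar_chains C (Suc n) x"
    using keys_cmul[of "(-1) ^ n" "frag_of (bar_push C g gs)"] bar_push_in[OF g(2,3)] g(4) by auto
  ultimately show ?case
    unfolding g(1) bar_boundary_snoc_Suc[OF len, of C x g "Dom C g"]
    using g(4) by (intro order_trans[OF keys_add]) simp
qed

lemma bar_boundary_hom:
  "bar_boundary C n x \<in> hom (free_Abelian_group (bar_chains C (Suc n) x))
                            (free_Abelian_group (bar_chains C n x))"
proof -
  have "bar_boundary C n x = frag_extend (\<lambda>fs. bar_boundary C n x (frag_of fs))"
    unfolding bar_boundary_def by simp
  then show ?thesis
    using hom_frag_extend bar_boundary_of_in by metis
qed

lemma bar_boundary_push_of:
  assumes "fs \<in> bar_chains C (Suc n) (Dom C f)" "f \<in> Arr C"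
  shows "bar_boundary C n (Cod C f) (frag_of (bar_push C f fs)) =
    On_arr (bar C n) f (bar_boundary C n (Dom C f) (frag_of fs))"
proof -
  from assms(1) obtain gs g where g: "fs = gs @ [g]" "gs \<in> bar_chains C n (Dom C g)" "g \<in> Arr C"
      "Cod C g = Dom C f"
    by (rule bar_chains_SucE)
  have snoc: "bar_snoc (Comp C g f) c = On_arr (bar C n) f (bar_snoc g c)" for c
    unfolding bar_snoc_def On_arr_bar
    using frag_extend_compose[of "\<lambda>fs. frag_of (bar_push C f fs)" "\<lambda>gs. gs @ [g]" c]
    by (simp add: o_def)
  show ?thesis
  proof (cases n)
    case 0
    with g obtain h where h: "gs = [h]" "h \<in> Arr C" "Cod C h = Dom C g"
      by (auto simp: bar_chains_0)
    show ?thesis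
      using g h assms(2) 0
      by (simp add: bar_push_def bar_boundary_pair On_arr_bar frag_extend_diff Comp_assoc)
  next
    case (Suc m)
    then have len: "length gs = Suc (Suc m)" using g by (simp add: bar_chains_def)
    show ?thesis
      unfolding g(1) Suc bar_push_snoc bar_boundary_snoc_Suc[OF len, of C _ _ "Dom C g"]
      using snoc g assms(2) Suc
      by (simp add: On_arr_bar frag_extend_add frag_extend_cmul bar_push_Comp)
  qed
qed

lemma nat_trans_bar_boundary: "nat_trans C (bar C (Suc n)) (bar C n) (bar_boundary C n)"
proof -
  have "bar_boundary C n (Cod C f) (On_arr (bar C (Suc n)) f a) =
      On_arr (bar C n) f (bar_boundary C n (Dom C f) a)"
    if f: "f \<in> Arr C" and a: "Poly_Mapping.keys a \<subseteq> bar_chains C (Suc n) (Dom C f)" for f a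
  proof -
    have "(bar_boundary C n (Cod C f) \<circ> On_arr (bar C (Suc n)) f) a =
        (On_arr (bar C n) f \<circ> bar_boundary C n (Dom C f)) a"
    proof (rule hom_free_Abelian_group_eqI[OF _ _ group_free_Abelian_group _ a])
      show "bar_boundary C n (Cod C f) \<circ> On_arr (bar C (Suc n)) f
          \<in> hom (free_Abelian_group (bar_chains C (Suc n) (Dom C f)))
                (free_Abelian_group (bar_chains C n (Cod C f)))"
        by (rule hom_compose[OF On_arr_bar_hom[OF f] bar_boundary_hom])
      show "On_arr (bar C n) f \<circ> bar_boundary C n (Dom C f)
          \<in> hom (free_Abelian_group (bar_chains C (Suc n) (Dom C f)))
                (free_Abelian_group (bar_chains C n (Cod C f)))"
        by (rule hom_compose[OF bar_boundary_hom On_arr_bar_hom[OF f]])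
    qed (use bar_boundary_push_of f in \<open>simp add: On_arr_bar\<close>)
    then show ?thesis by simp
  qed
  then show ?thesis by (simp add: nat_trans_def bar_boundary_hom)
qed

lemma nat_trans_bar_aug: "nat_trans C (bar C 0) const_int bar_aug"
proof -
  have "bar_aug (Cod C f) (On_arr (bar C 0) f a) = bar_aug (Dom C f) a"
    if f: "f \<in> Arr C" and a: "Poly_Mapping.keys a \<subseteq> bar_chains C 0 (Dom C f)" for f a
    using a by (induction rule: frag_induction)
      (simp_all add: On_arr_bar frag_extend_diff bar_aug_diff)
  then show ?thesis by (simp add: nat_trans_def const_int_def bar_aug_hom)
qed

lemma Ident_chain: "x \<in> Obj C \<Longrightarrow> [Ident C x] \<in> bar_chains C 0 x"
  by (simp add: bar_chains_0 Ident_in Cod_Ident)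

lemma bar_homotopy_0:
  assumes "x \<in> Obj C" "Poly_Mapping.keys c \<subseteq> bar_chains C 0 x"
  shows "bar_boundary C 0 x (bar_snoc (Ident C x) c) =
    frag_cmul (bar_aug x c) (frag_of [Ident C x]) - c"
  using assms(2)
proof (induction rule: frag_induction)
  case (diff a b)
  have "bar_boundary C 0 x (bar_snoc (Ident C x) (a - b)) =
      bar_boundary C 0 x (bar_snoc (Ident C x) a) - bar_boundary C 0 x (bar_snoc (Ident C x) b)"
    by (simp add: bar_snoc_def bar_boundary_def frag_extend_diff)
  then show ?case
    unfolding diff by (simp add: bar_aug_diff frag_cmul_diff_distrib)
next
  case (one fs)
  then show ?case
    by (auto simp: bar_chains_0 bar_snoc_def bar_boundary_pair Comp_Ident)
qed (simp add: bar_snoc_def bar_boundary_def)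

lemma bar_homotopy_Suc:
  assumes "x \<in> Obj C" "Poly_Mapping.keys c \<subseteq> bar_chains C (Suc n) x"
  shows "bar_boundary C (Suc n) x (bar_snoc (Ident C x) c) =
    bar_snoc (Ident C x) (bar_boundary C n x c) + frag_cmul ((-1) ^ n) c"
  using assms(2)
proof (induction rule: frag_induction)
  case zero
  show ?case by (simp add: bar_snoc_def bar_boundary_def)
next
  case (diff a b)
  have "frag_cmul k (a - b) = frag_cmul k a - frag_cmul k b" for k
    by (rule poly_mapping_eqI) (simp add: lookup_minus right_diff_distrib)
  moreover have "bar_boundary C (Suc n) x (bar_snoc (Ident C x) (a - b)) =
      bar_boundary C (Suc n) x (bar_snoc (Ident C x) a) - bar_boundary C (Suc n) x (bar_snoc (Ident C x) b)"
    "bar_snoc (Ident C x) (bar_boundary C n x (a - b)) =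
      bar_snoc (Ident C x) (bar_boundary C n x a) - bar_snoc (Ident C x) (bar_boundary C n x b)"
    by (simp_all add: bar_snoc_def bar_boundary_def frag_extend_diff)
  ultimately show ?case
    using diff by simp
next
  case (one fs)
  then have "length fs = Suc (Suc n)" by (simp add: bar_chains_def)
  from bar_boundary_snoc_Suc[OF this, of C x "Ident C x" x] show ?case
    by (simp add: bar_snoc_def[of "Ident C x", THEN fun_cong, of "frag_of fs"] bar_push_Ident[OF one])
qed

lemma bar_exact_0:
  assumes x: "x \<in> Obj C"
  shows "bar_boundary C 0 x ` carrier (free_Abelian_group (bar_chains C 1 x)) =
    kernel (free_Abelian_group (bar_chains C 0 x)) integer_group (bar_aug x)"
    (is "?L = ?K")
proof
  have 0: "bar_aug x (bar_boundary C 0 x c) = 0" if "Poly_Mapping.keys c \<subseteq> bar_chains C (Suc 0) x" for c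
    using that
  proof (induction rule: frag_induction)
    case (one fs)
    then obtain f g where "fs = [f, g]"
      by (elim bar_chains_1E)
    then show ?case by (simp add: bar_boundary_pair bar_aug_diff)
  qed (simp_all add: bar_boundary_def frag_extend_diff bar_aug_diff)
  show "?L \<subseteq> ?K"
    using 0 hom_in_carrier[OF bar_boundary_hom[of 0 x]] by (fastforce simp: kernel_def integer_group_def)
  show "?K \<subseteq> ?L"
  proof
    fix c assume "c \<in> ?K"
    then have c: "Poly_Mapping.keys c \<subseteq> bar_chains C 0 x" "bar_aug x c = 0"
      by (auto simp: kernel_def integer_group_def)
    have "- bar_snoc (Ident C x) c \<in> carrier (free_Abelian_group (bar_chains C 1 x))"
      using hom_in_carrier[OF bar_snoc_in[OF Ident_in[OF x]], of c 0] c x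
      by (simp add: Dom_Ident Cod_Ident)
    moreover have "bar_boundary C 0 x (- bar_snoc (Ident C x) c) = c"
      using bar_homotopy_0[OF x c(1)] c(2) by (simp add: bar_boundary_def frag_extend_minus)
    ultimately show "c \<in> ?L" by (metis image_eqI)
  qed
qed

lemma bar_boundary_boundary:
  "Poly_Mapping.keys c \<subseteq> bar_chains C (Suc (Suc n)) x \<Longrightarrow>
    bar_boundary C n x (bar_boundary C (Suc n) x c) = 0"
proof (induction n arbitrary: c x)
  case (0 c x)
  then show ?case
  proof (induction rule: frag_induction)
    case (one fs)
    then obtain f g h where "fs = [f, g, h]" "f \<in> Arr C" "g \<in> Arr C" "h \<in> Arr C"
        "Cod C f = Dom C g" "Cod C g = Dom C h"
      by (elim bar_chains_2E)
    then show ?case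
      by (simp add: bar_boundary_def frag_extend_add frag_extend_diff frag_extend_minus bar_face_def
          Comp_assoc)
  qed (simp_all add: bar_boundary_def frag_extend_diff)
next
  case (Suc n c x)
  from Suc.prems show ?case
  proof (induction rule: frag_induction)
    case (one fs)
    from one obtain gs g where g: "fs = gs @ [g]" "gs \<in> bar_chains C (Suc (Suc n)) (Dom C g)"
        "g \<in> Arr C" "Cod C g = x"
      by (rule bar_chains_SucE)
    define y where "y = Dom C g"
    have y: "y \<in> Obj C" using g by (simp add: y_def Dom_in)
    let ?s = "bar_snoc (Ident C y)"
    have fs: "frag_of fs = On_arr (bar C (Suc (Suc (Suc n)))) g (?s (frag_of gs))"
      using g(3) by (simp add: On_arr_bar bar_snoc_def g(1) y_def Ident_Comp)
    have gs: "Poly_Mapping.keys (frag_of gs) \<subseteq> bar_chains C (Suc (Suc n)) y"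
      using g(2) by (simp add: y_def)
    have dgs: "Poly_Mapping.keys (bar_boundary C (Suc n) y (frag_of gs)) \<subseteq> bar_chains C (Suc n) y"
      using g(2) by (simp add: y_def bar_boundary_of_in)
    have sgs: "Poly_Mapping.keys (?s (frag_of gs)) \<subseteq> bar_chains C (Suc (Suc (Suc n))) y"
      using g(2) y by (auto simp: bar_snoc_def bar_chains_snoc y_def Ident_in Dom_Ident Cod_Ident)
    have "bar_boundary C (Suc (Suc n)) x (frag_of fs)
        = On_arr (bar C (Suc (Suc n))) g (bar_boundary C (Suc (Suc n)) y (?s (frag_of gs)))"
      using nat_trans_bar_boundary[of "Suc (Suc n)"] g(3,4) sgs
      unfolding nat_trans_def fs y_def by auto
    moreover have "Poly_Mapping.keys (bar_boundary C (Suc (Suc n)) y (?s (frag_of gs)))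
        \<subseteq> bar_chains C (Suc (Suc n)) y"
      using hom_in_carrier[OF bar_boundary_hom[of "Suc (Suc n)" y]] sgs by simp
    ultimately have *: "bar_boundary C (Suc n) x (bar_boundary C (Suc (Suc n)) x (frag_of fs))
        = On_arr (bar C (Suc n)) g
            (bar_boundary C (Suc n) y (bar_boundary C (Suc (Suc n)) y (?s (frag_of gs))))"
      using nat_trans_bar_boundary[of "Suc n"] g(3,4) unfolding nat_trans_def y_def by auto
    have "bar_boundary C (Suc n) y (bar_boundary C (Suc (Suc n)) y (?s (frag_of gs)))
        = bar_boundary C (Suc n) y (?s (bar_boundary C (Suc n) y (frag_of gs)))
          + frag_cmul ((-1) ^ Suc n) (bar_boundary C (Suc n) y (frag_of gs))"
      unfolding bar_homotopy_Suc[OF y gs]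
      by (simp add: bar_boundary_def frag_extend_add frag_extend_cmul frag_extend_minus)
    also have "\<dots> = ?s (bar_boundary C n y (bar_boundary C (Suc n) y (frag_of gs)))"
      unfolding bar_homotopy_Suc[OF y dgs]
      by (simp flip: frag_cmul_distrib)
    also have "\<dots> = 0"
      using Suc.IH[OF gs] by (simp add: bar_snoc_def)
    finally show ?case using * by (simp add: On_arr_bar)
  qed (simp_all add: bar_boundary_def frag_extend_diff)
qed

lemma bar_exact_Suc:
  assumes x: "x \<in> Obj C"
  shows "bar_boundary C (Suc n) x ` carrier (free_Abelian_group (bar_chains C (Suc (Suc n)) x)) =
    kernel (free_Abelian_group (bar_chains C (Suc n) x)) (free_Abelian_group (bar_chains C n x))
      (bar_boundary C n x)"
    (is "?L = ?K")
proof
  show "?L \<subseteq> ?K"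
    using bar_boundary_boundary hom_in_carrier[OF bar_boundary_hom[of "Suc n" x]]
    by (fastforce simp: kernel_def)
  show "?K \<subseteq> ?L"
  proof
    fix c assume "c \<in> ?K"
    then have c: "Poly_Mapping.keys c \<subseteq> bar_chains C (Suc n) x" "bar_boundary C n x c = 0"
      by (auto simp: kernel_def)
    let ?b = "frag_cmul ((-1) ^ n) (bar_snoc (Ident C x) c)"
    have "Poly_Mapping.keys (bar_snoc (Ident C x) c) \<subseteq> bar_chains C (Suc (Suc n)) x"
      using hom_in_carrier[OF bar_snoc_in[OF Ident_in[OF x]], of c "Suc n"] c x
      by (simp add: Dom_Ident Cod_Ident)
    then have "?b \<in> carrier (free_Abelian_group (bar_chains C (Suc (Suc n)) x))"
      using keys_cmul by fastforce
    moreover have "bar_boundary C (Suc n) x ?b = c"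
      using bar_homotopy_Suc[OF x c(1)] c(2)
      by (simp add: bar_boundary_def bar_snoc_def frag_extend_cmul flip: power_add mult_2)
    ultimately show "c \<in> ?L" by (metis image_eqI)
  qed
qed

lemma projective_bar: "projective C (bar C n) (T :: ('g \<times> 'h) itself)"
  unfolding projective_def
proof (intro conjI allI impI ab_functor_bar, elim conjE)
  fix F :: "('o, 'a, 'g) abfun" and G :: "('o, 'a, 'h) abfun" and \<eta> \<alpha>
  assume F: "ab_functor C F" and G: "ab_functor C G" and \<eta>: "nat_trans C F G \<eta>"
    and epi: "\<forall>x\<in>Obj C. \<eta> x ` carrier (On_obj F x) = carrier (On_obj G x)"
    and \<alpha>: "nat_trans C (bar C n) G \<alpha>"
  interpret F: ab_functor C F by (rule F)
  interpret G: ab_functor C G by (rule G)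
  define base where "base fs = butlast fs @ [Ident C (Dom C (last fs))]" for fs
  have last_in: "last fs \<in> Arr C" "Cod C (last fs) = x" if "fs \<in> bar_chains C n x" for fs x
    using that by (auto elim!: bar_chains_last)
  have base_in: "base fs \<in> bar_chains C n (Dom C (last fs))" if "fs \<in> bar_chains C n x" for fs x
  proof (cases n)
    case 0
    with that show ?thesis
      by (auto simp: bar_chains_0 base_def Ident_in Cod_Ident Dom_in)
  next
    case (Suc m)
    with that show ?thesis
      by (auto elim!: bar_chains_SucE simp: base_def bar_chains_snoc Ident_in Cod_Ident Dom_Ident Dom_in)
  qed
  have push_base: "bar_push C (last fs) (base fs) = fs" if "fs \<in> bar_chains C n x" for fs x
    using that by (auto elim!: bar_chains_last simp: base_def Ident_Comp)
  have "\<exists>p. p \<in> carrier (On_obj F (Dom C (last fs))) \<and>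
      \<eta> (Dom C (last fs)) p = \<alpha> (Dom C (last fs)) (frag_of (base fs))"
    if fs: "fs \<in> bar_chains C n x" for fs x
  proof -
    have o: "Dom C (last fs) \<in> Obj C" using last_in[OF fs] Dom_in by blast
    have h: "\<alpha> (Dom C (last fs)) \<in> hom (On_obj (bar C n) (Dom C (last fs))) (On_obj G (Dom C (last fs)))"
      using \<alpha> o by (simp add: nat_trans_def)
    have "\<alpha> (Dom C (last fs)) (frag_of (base fs)) \<in> carrier (On_obj G (Dom C (last fs)))"
      by (rule hom_in_carrier[OF h]) (use base_in[OF fs] in simp)
    then have "\<alpha> (Dom C (last fs)) (frag_of (base fs)) \<in> \<eta> (Dom C (last fs)) ` carrier (On_obj F (Dom C (last fs)))"
      using epi o by simp
    then show ?thesis by auto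
  qed
  then have "\<forall>fs\<in>(\<Union>x. bar_chains C n x). \<exists>p. p \<in> carrier (On_obj F (Dom C (last fs))) \<and>
      \<eta> (Dom C (last fs)) p = \<alpha> (Dom C (last fs)) (frag_of (base fs))"
    by blast
  then have "\<exists>p. \<forall>fs\<in>(\<Union>x. bar_chains C n x). p fs \<in> carrier (On_obj F (Dom C (last fs))) \<and>
      \<eta> (Dom C (last fs)) (p fs) = \<alpha> (Dom C (last fs)) (frag_of (base fs))"
    by (rule bchoice)
  then obtain p0 where "\<forall>fs\<in>(\<Union>x. bar_chains C n x). p0 fs \<in> carrier (On_obj F (Dom C (last fs))) \<and>
      \<eta> (Dom C (last fs)) (p0 fs) = \<alpha> (Dom C (last fs)) (frag_of (base fs))"
    by blast
  then have p0_in: "p0 fs \<in> carrier (On_obj F (Dom C (last fs)))"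
    and \<eta>_p0: "\<eta> (Dom C (last fs)) (p0 fs) = \<alpha> (Dom C (last fs)) (frag_of (base fs))"
    if "fs \<in> bar_chains C n x" for fs x
    using that by blast+
  define p where "p fs = p0 (base fs)" for fs
  have base_base: "base (base fs) = base fs" "Dom C (last (base fs)) = Dom C (last fs)"
    if "fs \<in> bar_chains C n x" for fs x
    using last_in[OF that] by (simp_all add: base_def Dom_Ident Dom_in)
  have p_in: "p fs \<in> carrier (On_obj F (Dom C (last fs)))"
    and \<eta>_p: "\<eta> (Dom C (last fs)) (p fs) = \<alpha> (Dom C (last fs)) (frag_of (base fs))"
    if "fs \<in> bar_chains C n x" for fs x
    using p0_in[OF base_in[OF that]] \<eta>_p0[OF base_in[OF that]] base_base[OF that]
    by (simp_all add: p_def)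
  define q where "q fs = On_arr F (last fs) (p fs)" for fs
  have q_in: "q fs \<in> carrier (On_obj F x)" if "fs \<in> bar_chains C n x" for fs x
    using hom_in_carrier[OF F.On_arr_hom p_in[OF that]] last_in[OF that] by (simp add: q_def)
  have "\<exists>h. h \<in> hom (free_Abelian_group (bar_chains C n x)) (On_obj F x) \<and>
      (\<forall>fs\<in>bar_chains C n x. h (frag_of fs) = q fs)" if "x \<in> Obj C" for x
    using comm_group.free_Abelian_group_universal[OF F.On_obj_comm_group[OF that],
        of q "bar_chains C n x"] q_in by (metis image_subsetI)
  then have "\<exists>\<beta>. \<forall>x\<in>Obj C. \<beta> x \<in> hom (free_Abelian_group (bar_chains C n x)) (On_obj F x) \<and>
      (\<forall>fs\<in>bar_chains C n x. \<beta> x (frag_of fs) = q fs)"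
    by (intro bchoice) blast
  then obtain \<beta> where \<beta>: "\<And>x. x \<in> Obj C \<Longrightarrow> \<beta> x \<in> hom (free_Abelian_group (bar_chains C n x)) (On_obj F x)"
    and \<beta>_of: "\<And>x fs. \<lbrakk>x \<in> Obj C; fs \<in> bar_chains C n x\<rbrakk> \<Longrightarrow> \<beta> x (frag_of fs) = q fs"
    by blast
  have gF: "group (On_obj F x)" and gG: "group (On_obj G x)" if "x \<in> Obj C" for x
    using F.On_obj_comm_group[OF that] G.On_obj_comm_group[OF that] by (simp_all add: comm_group.axioms(2))
  have q_push: "q (bar_push C f fs) = On_arr F f (q fs)"
    if f: "f \<in> Arr C" and fs: "fs \<in> bar_chains C n (Dom C f)" for f fs
  proof -
    have l: "last fs \<in> Arr C" "Cod C (last fs) = Dom C f" using last_in[OF fs] by auto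
    have b: "base (bar_push C f fs) = base fs"
      using l f by (simp add: base_def bar_push_def Dom_Comp)
    have "q (bar_push C f fs) = On_arr F (Comp C (last fs) f) (p fs)"
      by (simp add: q_def p_def b) (simp add: bar_push_def)
    also have "\<dots> = On_arr F f (q fs)"
      using F.On_arr_Comp[OF l(1) f l(2) p_in[OF fs]] by (simp add: q_def)
    finally show ?thesis .
  qed
  have "\<beta> (Cod C f) (On_arr (bar C n) f a) = On_arr F f (\<beta> (Dom C f) a)"
    if f: "f \<in> Arr C" and a: "Poly_Mapping.keys a \<subseteq> bar_chains C n (Dom C f)" for f a
  proof -
    note o = Dom_in[OF f] Cod_in[OF f]
    have "(\<beta> (Cod C f) \<circ> On_arr (bar C n) f) a = (On_arr F f \<circ> \<beta> (Dom C f)) a"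
    proof (rule hom_free_Abelian_group_eqI[OF _ _ gF[OF o(2)] _ a])
      show "\<beta> (Cod C f) \<circ> On_arr (bar C n) f
          \<in> hom (free_Abelian_group (bar_chains C n (Dom C f))) (On_obj F (Cod C f))"
        by (rule hom_compose[OF On_arr_bar_hom[OF f] \<beta>[OF o(2)]])
      show "On_arr F f \<circ> \<beta> (Dom C f)
          \<in> hom (free_Abelian_group (bar_chains C n (Dom C f))) (On_obj F (Cod C f))"
        by (rule hom_compose[OF \<beta>[OF o(1)] F.On_arr_hom[OF f]])
    qed (simp add: On_arr_bar \<beta>_of o bar_push_in f q_push)
    then show ?thesis by simp
  qed
  then have nat: "nat_trans C (bar C n) F \<beta>"
    by (simp add: nat_trans_def \<beta>)
  have \<eta>_nat: "\<eta> (Cod C f) (On_arr F f a) = On_arr G f (\<eta> (Dom C f) a)"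
    if "f \<in> Arr C" "a \<in> carrier (On_obj F (Dom C f))" for f a
    using \<eta> that by (simp add: nat_trans_def)
  have \<alpha>_nat: "\<alpha> (Cod C f) (On_arr (bar C n) f a) = On_arr G f (\<alpha> (Dom C f) a)"
    if "f \<in> Arr C" "a \<in> carrier (On_obj (bar C n) (Dom C f))" for f a
    using \<alpha> that by (simp add: nat_trans_def)
  have lift: "\<eta> x (\<beta> x a) = \<alpha> x a"
    if x: "x \<in> Obj C" and a: "Poly_Mapping.keys a \<subseteq> bar_chains C n x" for x a
  proof -
    have "(\<eta> x \<circ> \<beta> x) a = \<alpha> x a"
    proof (rule hom_free_Abelian_group_eqI[OF _ _ gG[OF x] _ a])
      show "\<eta> x \<circ> \<beta> x \<in> hom (free_Abelian_group (bar_chains C n x)) (On_obj G x)"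
        using \<eta> x by (intro hom_compose[OF \<beta>[OF x]]) (simp add: nat_trans_def)
      show "\<alpha> x \<in> hom (free_Abelian_group (bar_chains C n x)) (On_obj G x)"
        using \<alpha> x by (simp add: nat_trans_def)
      fix fs assume fs: "fs \<in> bar_chains C n x"
      note l = last_in[OF fs]
      have "\<eta> x (\<beta> x (frag_of fs)) = \<eta> (Cod C (last fs)) (On_arr F (last fs) (p fs))"
        by (simp add: \<beta>_of x fs q_def l)
      also have "\<dots> = On_arr G (last fs) (\<alpha> (Dom C (last fs)) (frag_of (base fs)))"
        using \<eta>_nat[OF l(1) p_in[OF fs]] \<eta>_p[OF fs] by simp
      also have "\<dots> = \<alpha> (Cod C (last fs)) (On_arr (bar C n) (last fs) (frag_of (base fs)))"
        using \<alpha>_nat[OF l(1), of "frag_of (base fs)"] base_in[OF fs] by simp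
      also have "\<dots> = \<alpha> x (frag_of fs)"
        by (simp add: On_arr_bar push_base[OF fs] l)
      finally show "(\<eta> x \<circ> \<beta> x) (frag_of fs) = \<alpha> x (frag_of fs)" by simp
    qed
    then show ?thesis by simp
  qed
  show "\<exists>\<beta>. nat_trans C (bar C n) F \<beta> \<and>
      (\<forall>x\<in>Obj C. \<forall>a\<in>carrier (On_obj (bar C n) x). \<eta> x (\<beta> x a) = \<alpha> x a)"
    using nat lift by auto
qed

theorem projective_resolution_bar:
  "projective_resolution C const_int (bar C) (bar_boundary C) bar_aug (T :: ('g \<times> 'h) itself)"
proof -
  have "bar_aug x ` carrier (free_Abelian_group (bar_chains C 0 x)) = UNIV" if x: "x \<in> Obj C" for x
  proof -
    have "k \<in> bar_aug x ` carrier (free_Abelian_group (bar_chains C 0 x))" for k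
    proof (rule image_eqI)
      show "k = bar_aug x (frag_cmul k (frag_of [Ident C x]))"
        by (subst bar_aug_eq[of "{[Ident C x]}"]) auto
      show "frag_cmul k (frag_of [Ident C x]) \<in> carrier (free_Abelian_group (bar_chains C 0 x))"
        using keys_cmul[of k "frag_of [Ident C x]"] Ident_chain[OF x] by auto
    qed
    then show ?thesis by auto
  qed
  then show ?thesis
    unfolding projective_resolution_def
    using projective_bar[of _ T] nat_trans_bar_boundary nat_trans_bar_aug bar_exact_0 bar_exact_Suc
    by (simp add: const_int_def integer_group_def)
qed

end

text \<open>The \<open>k\<close>-th left derived functor of \<open>colim\<close>, evaluated at the constant functor \<open>\<int>\<close>. As for any
  derived functor the result does not depend, up to isomorphism, on the chosen projective resolution;
  by theorem \<open>projective_resolution_bar\<close> the standard resolution is one.\<close>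

definition colim_derived_int ::
  "('o, 'a) cat \<Rightarrow> nat \<Rightarrow> ('o \<Rightarrow> ('a list \<Rightarrow>\<^sub>0 int)) set set monoid" where
  "colim_derived_int C k = colim_homology C (bar C) (bar_boundary C) k"


section \<open>Right sets over a monoid and their homology\<close>

locale right_mset = monoid M for M :: "('m, 'b) monoid_scheme" (structure) +
  fixes X :: "'x set" and act :: "'x \<Rightarrow> 'm \<Rightarrow> 'x"
  assumes act_in: "\<lbrakk>x \<in> X; \<mu> \<in> carrier M\<rbrakk> \<Longrightarrow> act x \<mu> \<in> X"
    and act_one: "x \<in> X \<Longrightarrow> act x \<one> = x"
    and act_mult: "\<lbrakk>x \<in> X; \<mu> \<in> carrier M; \<nu> \<in> carrier M\<rbrakk> \<Longrightarrow> act x (\<mu> \<otimes> \<nu>) = act (act x \<mu>) \<nu>"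

definition mset_cat ::
  "('m, 'b) monoid_scheme \<Rightarrow> 'x set \<Rightarrow> ('x \<Rightarrow> 'm \<Rightarrow> 'x) \<Rightarrow> ('x, 'x \<times> 'm \<times> 'x) cat" where
  "mset_cat M X act =
     \<lparr>Obj = X,
      Arr = {(x, \<mu>, x'). x \<in> X \<and> \<mu> \<in> carrier M \<and> x' \<in> X \<and> act x \<mu> = x'},
      Dom = (\<lambda>(x, \<mu>, x'). x),
      Cod = (\<lambda>(x, \<mu>, x'). x'),
      Ident = (\<lambda>x. (x, \<one>\<^bsub>M\<^esub>, x)),
      Comp = (\<lambda>(x, \<mu>, x') (y, \<nu>, y'). (x, \<mu> \<otimes>\<^bsub>M\<^esub> \<nu>, y'))\<rparr>"

definition mset_homology ::
  "nat \<Rightarrow> ('m, 'b) monoid_scheme \<Rightarrow> 'x set \<Rightarrow> ('x \<Rightarrow> 'm \<Rightarrow> 'x) \<Rightarrow>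
   ('x \<Rightarrow> (('x \<times> 'm \<times> 'x) list \<Rightarrow>\<^sub>0 int)) set set monoid" where
  "mset_homology k M X act = colim_derived_int (mset_cat M X act) k"

lemma (in right_mset) small_category_mset_cat: "small_category (mset_cat M X act)"
  by unfold_locales (auto simp: mset_cat_def act_in act_one act_mult m_assoc)

text \<open>A basis can always be taken inside the group, so \<open>B\<close> may range over subsets of the carrier.\<close>

definition is_free_abelian :: "('g, 'b) monoid_scheme \<Rightarrow> bool" where
  "is_free_abelian G \<longleftrightarrow> (\<exists>B\<subseteq>carrier G. free_Abelian_group B \<cong> G)"


section \<open>The pointed sets \<open>X\<^sub>m\<close>\<close>

datatype point = Base | Pt nat

text \<open>\<open>X_set m\<close> is \<open>{x\<^sub>0, \<dots>, x\<^sub>m, *}\<close>; for \<open>m = -1\<close> it is \<open>{*}\<close>.\<close>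

definition X_set :: "int \<Rightarrow> point set" where
  "X_set m = insert Base {Pt i | i. int i \<le> m}"

fun X_gen :: "int \<Rightarrow> point \<Rightarrow> 'e \<Rightarrow> point" where
  "X_gen m Base e = Base"
| "X_gen m (Pt i) e = (if int i < m then Pt (Suc i) else Base)"

text \<open>A trace acts through any of the words representing it; see \<open>X_act_class\<close> below.\<close>

definition X_act :: "int \<Rightarrow> point \<Rightarrow> 'e list set \<Rightarrow> point" where
  "X_act m x \<mu> = foldl (X_gen m) x (SOME w. w \<in> \<mu>)"

lemma foldl_X_gen_trace_rel:
  "(u, v) \<in> trace_rel E I \<Longrightarrow> foldl (X_gen m) x u = foldl (X_gen m) x v"
proof (induction arbitrary: x rule: trace_rel.induct)
  case (trace_comm a b)
  have "X_gen m y a = X_gen m y b" for y by (cases y) auto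
  then show ?case by simp
qed auto

lemma X_act_class:
  assumes "u \<in> lists E"
  shows "X_act m x (trace_rel E I `` {u}) = foldl (X_gen m) x u"
proof -
  let ?w = "SOME w. w \<in> trace_rel E I `` {u}"
  have "?w \<in> trace_rel E I `` {u}"
    by (rule someI[of _ u]) (use trace_refl[OF assms] in simp)
  then show ?thesis
    using foldl_X_gen_trace_rel[of u ?w E I m x] by (simp add: X_act_def)
qed

lemma X_act_generator:
  assumes "e \<in> E"
  shows "X_act m x (trace_rel E I `` {[e]}) = X_gen m x e"
  using X_act_class[of "[e]" E m x I] assms by simp

lemma X_gen_in: "x \<in> X_set m \<Longrightarrow> X_gen m x e \<in> X_set m"
  by (cases x) (auto simp: X_set_def)

lemma right_mset_X:
  assumes "I \<subseteq> E \<times> E"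
  shows "right_mset (trace_monoid E I) (X_set m) (X_act m)"
proof -
  let ?M = "trace_monoid E I" and ?R = "trace_rel E I"
  have rep: "\<exists>u\<in>lists E. A = ?R `` {u}" if "A \<in> carrier ?M" for A
    using that by (auto simp: trace_monoid_def elim!: quotientE)
  have fold_in: "foldl (X_gen m) x u \<in> X_set m" if "x \<in> X_set m" for x and u :: "'a list"
    using that by (induction u arbitrary: x) (auto simp: X_gen_in)
  show ?thesis
  proof (intro right_mset.intro right_mset_axioms.intro monoid_trace_monoid assms)
    fix x \<mu> assume "x \<in> X_set m" "\<mu> \<in> carrier ?M"
    then show "X_act m x \<mu> \<in> X_set m"
      using rep[of \<mu>] fold_in X_act_class by metis
  next
    fix x show "X_act m x \<one>\<^bsub>?M\<^esub> = x"
      using X_act_class[of "[]" E m x I] by (simp add: trace_monoid_def)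
  next
    fix x \<mu> \<nu> assume "\<mu> \<in> carrier ?M" "\<nu> \<in> carrier ?M"
    then obtain u v where uv: "u \<in> lists E" "v \<in> lists E" "\<mu> = ?R `` {u}" "\<nu> = ?R `` {v}"
      using rep by meson
    then have "u @ v \<in> lists E" by simp
    with uv show "X_act m x (\<mu> \<otimes>\<^bsub>?M\<^esub> \<nu>) = X_act m (X_act m x \<mu>) \<nu>"
      by (simp add: trace_monoid_mult[OF assms] X_act_class)
  qed
qed

end

theory Submission
  imports Defs
begin

text \<open>Write \<open>e\<^sub>i\<close> for the arrow given by the generator \<open>e\<close> at \<open>x\<^sub>i\<close>, with \<open>x\<^sub>m\<^sub>+\<^sub>1 = *\<close> and \<open>e\<^sub>*\<close> for
  the loop at \<open>*\<close>. The 1-chains of the nerve modulo boundaries are generated by these arrows, and a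
  pair \<open>(a, b) \<in> I\<close> imposes \<open>a\<^sub>i + b\<^sub>i\<^sub>+\<^sub>1 = b\<^sub>i + a\<^sub>i\<^sub>+\<^sub>1\<close>. Thus \<open>d\<^sub>i(e) = e\<^sub>i - e\<^sub>i\<^sub>+\<^sub>1\<close> depends only on
  the connected component of \<open>e\<close> in the graph \<open>(E, I)\<close>, and there are no other relations. Fix
  \<open>c \<in> E\<close> and contract the spanning tree formed by \<open>c\<^sub>0, \<dots>, c\<^sub>m\<close>: the loops \<open>e\<^sub>*\<close> together with
  the cycles \<open>d\<^sub>i(r) - d\<^sub>i(c)\<close>, where \<open>i \<le> m\<close> and \<open>r\<close> represents a component not containing \<open>c\<close>,
  form a basis of \<open>H\<^sub>1\<close>.\<close>

section \<open>Chains\<close>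

lemma frag_extend_frag_extend:
  "frag_extend f (frag_extend g c) = frag_extend (\<lambda>x. frag_extend f (g x)) c"
  using subset_UNIV by (induction c rule: frag_induction) (auto simp: frag_extend_diff)

lemma keys_frag_extend_subset:
  assumes "\<And>s. s \<in> S \<Longrightarrow> Poly_Mapping.keys (f s) \<subseteq> T" "Poly_Mapping.keys c \<subseteq> S"
  shows "Poly_Mapping.keys (frag_extend f c) \<subseteq> T"
  using keys_frag_extend[of f c] assms by blast

lemma keys_diff_subset:
  "\<lbrakk>Poly_Mapping.keys a \<subseteq> S; Poly_Mapping.keys b \<subseteq> S\<rbrakk> \<Longrightarrow> Poly_Mapping.keys (a - b) \<subseteq> S"
  using keys_diff[of a b] by blast

lemma keys_add_subset:
  "\<lbrakk>Poly_Mapping.keys a \<subseteq> S; Poly_Mapping.keys b \<subseteq> S\<rbrakk> \<Longrightarrow> Poly_Mapping.keys (a + b) \<subseteq> S"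
  using keys_add[of a b] by blast

text \<open>The definition asks for a basis inside the carrier. The images of the generators under
  the inverse isomorphism form one: they are equipollent to \<open>S\<close>, and equipollent sets
  give isomorphic free abelian groups.\<close>

lemma is_free_abelianI:
  assumes "G \<cong> free_Abelian_group S" "group G"
  shows "is_free_abelian G"
proof -
  have "free_Abelian_group S \<cong> G"
    by (rule group.iso_sym[OF assms(2,1)])
  then obtain h where h: "h \<in> hom (free_Abelian_group S) G"
      "bij_betw h (carrier (free_Abelian_group S)) (carrier G)"
    by (auto simp: is_iso_def iso_def)
  let ?B = "(\<lambda>s. h (frag_of s)) ` S"
  have "inj_on (\<lambda>s. h (frag_of s)) S"
    by (rule inj_onI) (use bij_betw_imp_inj_on[OF h(2)] in \<open>fastforce simp: inj_on_def frag_of_eq\<close>)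
  then have "?B \<approx> S"
    by (rule inj_on_image_eqpoll_self)
  then have "free_Abelian_group ?B \<cong> free_Abelian_group S"
    by (simp add: isomorphic_free_Abelian_groups)
  then have "free_Abelian_group ?B \<cong> G"
    using \<open>free_Abelian_group S \<cong> G\<close> by (rule iso_trans)
  moreover have "?B \<subseteq> carrier G"
    using hom_in_carrier[OF h(1)] by auto
  ultimately show ?thesis
    unfolding is_free_abelian_def by blast
qed

section \<open>First homology of a small category\<close>

definition composable :: "('o, 'a) cat \<Rightarrow> ('a \<times> 'a) set" where
  "composable C = {(f, g). f \<in> Arr C \<and> g \<in> Arr C \<and> Cod C f = Dom C g}"

definition arr_boundary :: "('o, 'a) cat \<Rightarrow> ('a \<Rightarrow>\<^sub>0 int) \<Rightarrow> ('o \<Rightarrow>\<^sub>0 int)" where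
  "arr_boundary C = frag_extend (\<lambda>f. frag_of (Cod C f) - frag_of (Dom C f))"

text \<open>The alternating sum of the three faces of a 2-simplex of the nerve. The complex is not
  normalised: identities are nonzero chains that merely bound.\<close>

definition pair_boundary :: "('o, 'a) cat \<Rightarrow> ('a \<times> 'a \<Rightarrow>\<^sub>0 int) \<Rightarrow> ('a \<Rightarrow>\<^sub>0 int)" where
  "pair_boundary C = frag_extend (\<lambda>(f, g). frag_of g - frag_of (Comp C f g) + frag_of f)"

definition bounding :: "('o, 'a) cat \<Rightarrow> ('a \<Rightarrow>\<^sub>0 int) set" where
  "bounding C = pair_boundary C ` {c. Poly_Mapping.keys c \<subseteq> composable C}"

lemma bounding_0: "0 \<in> bounding C"
  unfolding bounding_def pair_boundary_def by (rule image_eqI[of _ _ 0]) auto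

lemma bounding_diff: "\<lbrakk>a \<in> bounding C; b \<in> bounding C\<rbrakk> \<Longrightarrow> a - b \<in> bounding C"
  unfolding bounding_def pair_boundary_def
  by (auto simp: keys_diff_subset simp flip: frag_extend_diff)

lemma bounding_uminus: "a \<in> bounding C \<Longrightarrow> - a \<in> bounding C"
  using bounding_diff[OF bounding_0] by simp

lemma bounding_add: "\<lbrakk>a \<in> bounding C; b \<in> bounding C\<rbrakk> \<Longrightarrow> a + b \<in> bounding C"
  using bounding_diff[of a C "- b"] bounding_uminus by fastforce

lemma bounding_Comp:
  "\<lbrakk>f \<in> Arr C; g \<in> Arr C; Cod C f = Dom C g\<rbrakk> \<Longrightarrow> frag_of g - frag_of (Comp C f g) + frag_of f \<in> bounding C"
  unfolding bounding_def pair_boundary_def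
  by (rule image_eqI[of _ _ "frag_of (f, g)"]) (auto simp: composable_def)

section \<open>Colimits of the bar functors as free abelian groups\<close>

context small_category
begin

lemma ab_diagram_bar: "ab_diagram C (bar C n)"
  by (intro ab_diagram.intro ab_functor_bar) unfold_locales

text \<open>All three faces of the 2-simplex made of two identities are the identity; two of them
  cancel.\<close>

lemma bounding_Ident:
  assumes "x \<in> Obj C" shows "frag_of (Ident C x) \<in> bounding C"
  using bounding_Comp[of "Ident C x" C "Ident C x"] Comp_Ident[of "Ident C x"] assms
  by (simp add: Ident_in Dom_Ident Cod_Ident)

text \<open>\<open>bar C n\<close> is a direct sum of functors
  \<open>\<int>[C(c\<^sub>n, -)]\<close>, one for each sequence
  \<open>c\<^sub>0 \<rightarrow> ... \<rightarrow> c\<^sub>n\<close>, and each has colimit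
  \<open>\<int>\<close>. In the applications \<open>key\<close> labels the summand of a chain and
  \<open>ch k\<close> is its universal element at \<open>at k\<close>; by \<open>fill\<close> every
  chain is a push-forward of it.\<close>

lemma colim_bar_iso:
  assumes push: "\<And>f fs. \<lbrakk>f \<in> Arr C; fs \<in> bar_chains C n (Dom C f)\<rbrakk> \<Longrightarrow> key (bar_push C f fs) = key fs"
    and key_in: "\<And>x fs. fs \<in> bar_chains C n x \<Longrightarrow> key fs \<in> T"
    and at: "\<And>k. k \<in> T \<Longrightarrow> at k \<in> Obj C"
    and ch: "\<And>k. k \<in> T \<Longrightarrow> ch k \<in> bar_chains C n (at k) \<and> key (ch k) = k"
    and fill: "\<And>x fs. fs \<in> bar_chains C n x \<Longrightarrow>
      \<exists>f\<in>Arr C. Dom C f = at (key fs) \<and> Cod C f = x \<and> bar_push C f (ch (key fs)) = fs"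
  obtains \<alpha> where "\<alpha> \<in> iso (colim C (bar C n)) (free_Abelian_group T)"
    and "\<And>x a. \<lbrakk>x \<in> Obj C; Poly_Mapping.keys a \<subseteq> bar_chains C n x\<rbrakk> \<Longrightarrow>
      \<alpha> (colim_inj C (bar C n) x a) = frag_extend (\<lambda>fs. frag_of (key fs)) a"
proof -
  interpret D: ab_diagram C "bar C n" by (rule ab_diagram_bar)
  let ?K = "colim C (bar C n)" and ?F = "free_Abelian_group T"
  let ?e = "frag_extend (\<lambda>fs. frag_of (key fs))"
  have gK: "group ?K" by (rule comm_group.axioms(2)[OF D.comm_group_colim])
  have inj_hom: "colim_inj C (bar C n) x \<in> hom (free_Abelian_group (bar_chains C n x)) ?K"
    if "x \<in> Obj C" for x using D.colim_inj_hom[OF that] by simp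
  obtain \<alpha> where \<alpha>: "\<alpha> \<in> hom ?K ?F"
    and \<alpha>_inj: "\<And>x a. \<lbrakk>x \<in> Obj C; Poly_Mapping.keys a \<subseteq> bar_chains C n x\<rbrakk> \<Longrightarrow>
      \<alpha> (colim_inj C (bar C n) x a) = ?e a"
  proof (rule D.colim_universal[OF abelian_free_Abelian_group, of "\<lambda>x. ?e" T])
    fix x
    show "?e \<in> hom (On_obj (bar C n) x) ?F"
      using hom_frag_extend[of "bar_chains C n x" "\<lambda>fs. frag_of (key fs)" T] key_in by auto
  next
    fix f a assume f: "f \<in> Arr C" and "a \<in> carrier (On_obj (bar C n) (Dom C f))"
    then have a: "Poly_Mapping.keys a \<subseteq> bar_chains C n (Dom C f)" by simp
    have "?e (On_arr (bar C n) f a) = frag_extend (\<lambda>fs. frag_of (key (bar_push C f fs))) a"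
      by (simp add: On_arr_bar frag_extend_frag_extend)
    also have "\<dots> = ?e a"
      by (rule frag_extend_eq) (use a f push in auto)
    finally show "?e (On_arr (bar C n) f a) = ?e a" .
  qed auto
  \<comment> \<open>The inverse \<open>\<Lambda>\<close> sends \<open>k\<close> to the class of its
    representative chain \<open>ch k\<close>.\<close>
  have "(\<lambda>k. colim_inj C (bar C n) (at k) (frag_of (ch k))) ` T \<subseteq> carrier ?K"
    using hom_in_carrier[OF inj_hom[OF at]] ch by auto
  from comm_group.free_Abelian_group_universal[OF D.comm_group_colim this]
  obtain \<Lambda> where \<Lambda>: "\<Lambda> \<in> hom ?F ?K"
    and \<Lambda>_of: "\<And>k. k \<in> T \<Longrightarrow> \<Lambda> (frag_of k) = colim_inj C (bar C n) (at k) (frag_of (ch k))"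
    by blast
  have \<alpha>\<Lambda>: "\<alpha> (\<Lambda> c) = c" if c: "c \<in> carrier ?F" for c
  proof -
    have "(\<alpha> \<circ> \<Lambda>) c = id c"
    proof (rule hom_free_Abelian_group_eqI[OF hom_compose[OF \<Lambda> \<alpha>] _ group_free_Abelian_group])
      show "id \<in> hom ?F ?F" by (rule homI) auto
      show "(\<alpha> \<circ> \<Lambda>) (frag_of s) = id (frag_of s)" if "s \<in> T" for s
        using that \<alpha>_inj[OF at, of s "frag_of (ch s)"] ch[of s] by (simp add: \<Lambda>_of)
    qed (use c in simp)
    then show ?thesis by simp
  qed
  have \<Lambda>\<alpha>_of: "\<Lambda> (\<alpha> (colim_inj C (bar C n) x (frag_of fs))) = colim_inj C (bar C n) x (frag_of fs)"
    if fs: "fs \<in> bar_chains C n x" and x: "x \<in> Obj C" for x fs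
  proof -
    obtain f where f: "f \<in> Arr C" "Dom C f = at (key fs)" "Cod C f = x" "bar_push C f (ch (key fs)) = fs"
      using fill[OF fs] by blast
    have "\<Lambda> (\<alpha> (colim_inj C (bar C n) x (frag_of fs)))
        = colim_inj C (bar C n) (at (key fs)) (frag_of (ch (key fs)))"
      using \<alpha>_inj[OF x, of "frag_of fs"] fs key_in[OF fs] by (simp add: \<Lambda>_of)
    \<comment> \<open>The chain \<open>fs\<close> is \<open>ch (key fs)\<close> pushed along
      \<open>f\<close>, and the colimit identifies the two.\<close>
    also have "\<dots> = colim_inj C (bar C n) x (frag_of fs)"
      using D.colim_inj_cocone[OF f(1), of "frag_of (ch (key fs))"] ch[OF key_in[OF fs]] f
      by (simp add: On_arr_bar)
    finally show ?thesis .
  qed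
  have \<Lambda>\<alpha>: "\<Lambda> (\<alpha> z) = z" if z: "z \<in> carrier ?K" for z
  proof -
    have "(\<Lambda> \<circ> \<alpha>) z = id z"
    proof (rule D.colim_hom_eqI[OF hom_compose[OF \<alpha> \<Lambda>] _ gK _ z])
      show "id \<in> hom ?K ?K" by (rule homI) auto
      fix x a assume x: "x \<in> Obj C" and "a \<in> carrier (On_obj (bar C n) x)"
      then have a: "Poly_Mapping.keys a \<subseteq> bar_chains C n x" by simp
      have "((\<Lambda> \<circ> \<alpha>) \<circ> colim_inj C (bar C n) x) a = colim_inj C (bar C n) x a"
        by (rule hom_free_Abelian_group_eqI[OF hom_compose[OF inj_hom[OF x] hom_compose[OF \<alpha> \<Lambda>]]
              inj_hom[OF x] gK _ a]) (use \<Lambda>\<alpha>_of x in simp)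
      then show "(\<Lambda> \<circ> \<alpha>) (colim_inj C (bar C n) x a) = id (colim_inj C (bar C n) x a)" by simp
    qed
    then show ?thesis by simp
  qed
  have "bij_betw \<alpha> (carrier ?K) (carrier ?F)"
    by (rule bij_betw_byWitness[of _ \<Lambda>])
      (use \<alpha>\<Lambda> \<Lambda>\<alpha> hom_in_carrier[OF \<alpha>] hom_in_carrier[OF \<Lambda>] in auto)
  with \<alpha> have "\<alpha> \<in> iso ?K ?F" by (simp add: iso_def)
  with that \<alpha>_inj show thesis by blast
qed

text \<open>In degree 0 the label of a chain is the object \<open>c\<^sub>0\<close>, the source of
  its only arrow.\<close>

lemma colim_bar_0_iso:
  obtains \<alpha> where "\<alpha> \<in> iso (colim C (bar C 0)) (free_Abelian_group (Obj C))"
    and "\<And>x a. \<lbrakk>x \<in> Obj C; Poly_Mapping.keys a \<subseteq> bar_chains C 0 x\<rbrakk> \<Longrightarrow>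
      \<alpha> (colim_inj C (bar C 0) x a) = frag_extend (\<lambda>fs. frag_of (Dom C (hd fs))) a"
proof (rule colim_bar_iso[of 0 "\<lambda>fs. Dom C (hd fs)" "Obj C" "\<lambda>x. x" "\<lambda>x. [Ident C x]"])
  fix x fs assume "fs \<in> bar_chains C 0 x"
  then obtain f where "fs = [f]" "f \<in> Arr C" "Cod C f = x" by (auto simp: bar_chains_0)
  then show "\<exists>f\<in>Arr C. Dom C f = Dom C (hd fs) \<and> Cod C f = x \<and>
      bar_push C f [Ident C (Dom C (hd fs))] = fs"
    by (intro bexI[of _ f]) (auto simp: bar_push_def Ident_Comp)
qed (auto simp: bar_chains_0 bar_push_def Dom_Comp Dom_in Ident_in Cod_Ident Dom_Ident)

lemma colim_bar_1_iso:
  obtains \<alpha> where "\<alpha> \<in> iso (colim C (bar C (Suc 0))) (free_Abelian_group (Arr C))"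
    and "\<And>x a. \<lbrakk>x \<in> Obj C; Poly_Mapping.keys a \<subseteq> bar_chains C (Suc 0) x\<rbrakk> \<Longrightarrow>
      \<alpha> (colim_inj C (bar C (Suc 0)) x a) = frag_extend (\<lambda>fs. frag_of (hd fs)) a"
proof (rule colim_bar_iso[of "Suc 0" hd "Arr C" "Cod C" "\<lambda>f. [f, Ident C (Cod C f)]"])
  fix x fs assume "fs \<in> bar_chains C (Suc 0) x"
  then obtain f g where fg: "fs = [f, g]" "f \<in> Arr C" "g \<in> Arr C" "Cod C f = Dom C g" "Cod C g = x"
    by (elim bar_chains_1E)
  then show "\<exists>f\<in>Arr C. Dom C f = Cod C (hd fs) \<and> Cod C f = x \<and>
      bar_push C f [hd fs, Ident C (Cod C (hd fs))] = fs"
    by (intro bexI[of _ g]) (auto simp: bar_push_def Ident_Comp)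
next
  fix f assume "f \<in> Arr C"
  then show "[f, Ident C (Cod C f)] \<in> bar_chains C (Suc 0) (Cod C f) \<and> hd [f, Ident C (Cod C f)] = f"
    using bar_chains_snoc[of "[f]" "Ident C (Cod C f)" C 0]
    by (simp add: bar_chains_0 Ident_in Cod_in Dom_Ident Cod_Ident)
qed (auto simp: bar_push_def Cod_in elim!: bar_chains_1E)

lemma colim_bar_2_iso:
  obtains \<alpha> where "\<alpha> \<in> iso (colim C (bar C (Suc (Suc 0)))) (free_Abelian_group (composable C))"
    and "\<And>x a. \<lbrakk>x \<in> Obj C; Poly_Mapping.keys a \<subseteq> bar_chains C (Suc (Suc 0)) x\<rbrakk> \<Longrightarrow>
      \<alpha> (colim_inj C (bar C (Suc (Suc 0))) x a) = frag_extend (\<lambda>fs. frag_of (hd fs, fs ! 1)) a"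
proof (rule colim_bar_iso[of "Suc (Suc 0)" "\<lambda>fs. (hd fs, fs ! 1)" "composable C" "\<lambda>(f, g). Cod C g"
      "\<lambda>(f, g). [f, g, Ident C (Cod C g)]"])
  fix x fs assume "fs \<in> bar_chains C (Suc (Suc 0)) x"
  then obtain f g h where "fs = [f, g, h]" "f \<in> Arr C" "g \<in> Arr C" "h \<in> Arr C"
      "Cod C f = Dom C g" "Cod C g = Dom C h" "Cod C h = x"
    by (elim bar_chains_2E)
  then show "\<exists>f\<in>Arr C. Dom C f = (case (hd fs, fs ! 1) of (f, g) \<Rightarrow> Cod C g) \<and> Cod C f = x \<and>
      bar_push C f (case (hd fs, fs ! 1) of (f, g) \<Rightarrow> [f, g, Ident C (Cod C g)]) = fs"
    by (intro bexI[of _ h]) (auto simp: bar_push_def Ident_Comp)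
next
  fix k assume "k \<in> composable C"
  then obtain f g where k: "k = (f, g)" "f \<in> Arr C" "g \<in> Arr C" "Cod C f = Dom C g"
    by (auto simp: composable_def)
  then show "(case k of (f, g) \<Rightarrow> [f, g, Ident C (Cod C g)])
        \<in> bar_chains C (Suc (Suc 0)) (case k of (f, g) \<Rightarrow> Cod C g) \<and>
      (hd (case k of (f, g) \<Rightarrow> [f, g, Ident C (Cod C g)]),
       (case k of (f, g) \<Rightarrow> [f, g, Ident C (Cod C g)]) ! 1) = k"
    using bar_chains_snoc[of "[f, g]" "Ident C (Cod C g)" C "Suc 0"] bar_chains_snoc[of "[f]" g C 0]
    by (simp add: bar_chains_0 Ident_in Cod_in Dom_Ident Cod_Ident)
qed (auto simp: bar_push_def Cod_in composable_def elim!: bar_chains_2E)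

end

lemma arr_boundary_bounding:
  assumes "small_category C" "c \<in> bounding C"
  shows "arr_boundary C c = 0"
proof -
  interpret small_category C by fact
  from assms(2) obtain d where d: "c = pair_boundary C d" "Poly_Mapping.keys d \<subseteq> composable C"
    by (auto simp: bounding_def)
  have "arr_boundary C (pair_boundary C d) = 0"
    unfolding arr_boundary_def pair_boundary_def frag_extend_frag_extend
    by (rule frag_extend_eq_0)
      (use d(2) in \<open>auto simp: composable_def frag_extend_add frag_extend_diff Dom_Comp Cod_Comp\<close>)
  with d show ?thesis by simp
qed

section \<open>Boundary maps of the colimit complex in coordinates\<close>

context small_category
begin

text \<open>Homomorphisms out of the colimit are determined by the classes of single chains, so the
  computation \<open>eq\<close> for one chain identifies the induced boundary with the linear
  extension of \<open>p\<close>.\<close>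

lemma colim_bar_boundary_coords:
  assumes \<alpha>: "\<alpha> \<in> hom (colim C (bar C (Suc n))) (free_Abelian_group T)"
    and \<alpha>_inj: "\<And>x a. \<lbrakk>x \<in> Obj C; Poly_Mapping.keys a \<subseteq> bar_chains C (Suc n) x\<rbrakk> \<Longrightarrow>
      \<alpha> (colim_inj C (bar C (Suc n)) x a) = frag_extend (\<lambda>fs. frag_of (key fs)) a"
    and \<beta>: "\<beta> \<in> hom (colim C (bar C n)) (free_Abelian_group U)"
    and \<beta>_inj: "\<And>x a. \<lbrakk>x \<in> Obj C; Poly_Mapping.keys a \<subseteq> bar_chains C n x\<rbrakk> \<Longrightarrow>
      \<beta> (colim_inj C (bar C n) x a) = frag_extend (\<lambda>fs. frag_of (key' fs)) a"
    and p: "\<And>k. k \<in> T \<Longrightarrow> Poly_Mapping.keys (p k) \<subseteq> U"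
    and eq: "\<And>x fs. fs \<in> bar_chains C (Suc n) x \<Longrightarrow>
      frag_extend (\<lambda>fs. frag_of (key' fs)) (bar_boundary C n x (frag_of fs)) = p (key fs)"
    and z: "z \<in> carrier (colim C (bar C (Suc n)))"
  shows "\<beta> (colim_map C (bar C n) (bar_boundary C n) z) = frag_extend p (\<alpha> z)"
proof -
  interpret D: ab_diagram C "bar C (Suc n)" by (rule ab_diagram_bar)
  let ?d = "colim_map C (bar C n) (bar_boundary C n)"
  note d = colim_map_hom_inj[OF ab_diagram_bar ab_diagram_bar nat_trans_bar_boundary]
  have "(\<beta> \<circ> ?d) z = (frag_extend p \<circ> \<alpha>) z"
  proof (rule D.colim_hom_eqI[OF hom_compose[OF d(1) \<beta>] hom_compose[OF \<alpha> hom_frag_extend[OF p]]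
        group_free_Abelian_group _ z])
    fix x a assume x: "x \<in> Obj C" and "a \<in> carrier (On_obj (bar C (Suc n)) x)"
    then have a: "Poly_Mapping.keys a \<subseteq> bar_chains C (Suc n) x" by simp
    have b: "Poly_Mapping.keys (bar_boundary C n x a) \<subseteq> bar_chains C n x"
      using hom_in_carrier[OF bar_boundary_hom] a by simp
    have "(\<beta> \<circ> ?d) (colim_inj C (bar C (Suc n)) x a)
        = frag_extend (\<lambda>fs. frag_of (key' fs)) (bar_boundary C n x a)"
      using d(2)[OF x, of a] a \<beta>_inj[OF x b] by simp
    also have "\<dots> = frag_extend (\<lambda>fs. frag_extend (\<lambda>fs. frag_of (key' fs)) (bar_boundary C n x (frag_of fs))) a"
      by (simp add: bar_boundary_def frag_extend_frag_extend)
    also have "\<dots> = frag_extend (\<lambda>fs. p (key fs)) a"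
      by (rule frag_extend_eq) (use a eq in auto)
    also have "\<dots> = (frag_extend p \<circ> \<alpha>) (colim_inj C (bar C (Suc n)) x a)"
      using \<alpha>_inj[OF x a] by (simp add: frag_extend_frag_extend)
    finally show "(\<beta> \<circ> ?d) (colim_inj C (bar C (Suc n)) x a)
        = (frag_extend p \<circ> \<alpha>) (colim_inj C (bar C (Suc n)) x a)" .
  qed
  then show ?thesis by simp
qed

text \<open>Cycles are detected by injectivity of the coordinates in degree 0. Boundaries need
  surjectivity in degree 2, to find a preimage, and injectivity in degree 1, to compare its boundary
  with \<open>z\<close>.\<close>

lemma colim_bar_coords:
  obtains \<alpha> where "\<alpha> \<in> iso (colim C (bar C (Suc 0))) (free_Abelian_group (Arr C))"
    and "\<And>z. z \<in> carrier (colim C (bar C (Suc 0))) \<Longrightarrow>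
      colim_map C (bar C 0) (bar_boundary C 0) z = \<one>\<^bsub>colim C (bar C 0)\<^esub> \<longleftrightarrow> arr_boundary C (\<alpha> z) = 0"
    and "\<And>z. z \<in> carrier (colim C (bar C (Suc 0))) \<Longrightarrow>
      z \<in> colim_map C (bar C (Suc 0)) (bar_boundary C (Suc 0)) ` carrier (colim C (bar C (Suc (Suc 0))))
      \<longleftrightarrow> \<alpha> z \<in> bounding C"
proof -
  let ?K0 = "colim C (bar C 0)" and ?K1 = "colim C (bar C (Suc 0))" and ?K2 = "colim C (bar C (Suc (Suc 0)))"
  let ?d0 = "colim_map C (bar C 0) (bar_boundary C 0)"
    and ?d1 = "colim_map C (bar C (Suc 0)) (bar_boundary C (Suc 0))"
  have gK: "group (colim C (bar C n))" for n
    using ab_diagram.comm_group_colim[OF ab_diagram_bar] by (rule comm_group.axioms(2))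
  note d = colim_map_hom_inj(1)[OF ab_diagram_bar ab_diagram_bar nat_trans_bar_boundary]
  obtain \<alpha>0 where \<alpha>0: "\<alpha>0 \<in> iso ?K0 (free_Abelian_group (Obj C))"
    and \<alpha>0_inj: "\<And>x a. \<lbrakk>x \<in> Obj C; Poly_Mapping.keys a \<subseteq> bar_chains C 0 x\<rbrakk> \<Longrightarrow>
      \<alpha>0 (colim_inj C (bar C 0) x a) = frag_extend (\<lambda>fs. frag_of (Dom C (hd fs))) a"
    by (rule colim_bar_0_iso) blast
  obtain \<alpha>1 where \<alpha>1: "\<alpha>1 \<in> iso ?K1 (free_Abelian_group (Arr C))"
    and \<alpha>1_inj: "\<And>x a. \<lbrakk>x \<in> Obj C; Poly_Mapping.keys a \<subseteq> bar_chains C (Suc 0) x\<rbrakk> \<Longrightarrow>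
      \<alpha>1 (colim_inj C (bar C (Suc 0)) x a) = frag_extend (\<lambda>fs. frag_of (hd fs)) a"
    by (rule colim_bar_1_iso) blast
  obtain \<alpha>2 where \<alpha>2: "\<alpha>2 \<in> iso ?K2 (free_Abelian_group (composable C))"
    and \<alpha>2_inj: "\<And>x a. \<lbrakk>x \<in> Obj C; Poly_Mapping.keys a \<subseteq> bar_chains C (Suc (Suc 0)) x\<rbrakk> \<Longrightarrow>
      \<alpha>2 (colim_inj C (bar C (Suc (Suc 0))) x a) = frag_extend (\<lambda>fs. frag_of (hd fs, fs ! 1)) a"
    by (rule colim_bar_2_iso) blast
  have hom: "\<alpha>0 \<in> hom ?K0 (free_Abelian_group (Obj C))" "\<alpha>1 \<in> hom ?K1 (free_Abelian_group (Arr C))"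
      "\<alpha>2 \<in> hom ?K2 (free_Abelian_group (composable C))"
    using \<alpha>0 \<alpha>1 \<alpha>2 by (simp_all add: iso_def)
  have inj: "inj_on \<alpha>0 (carrier ?K0)" "inj_on \<alpha>1 (carrier ?K1)"
    and surj: "\<alpha>2 ` carrier ?K2 = carrier (free_Abelian_group (composable C))"
    using \<alpha>0 \<alpha>1 \<alpha>2 by (simp_all add: iso_def bij_betw_def)
  have \<alpha>0_d: "\<alpha>0 (?d0 z) = arr_boundary C (\<alpha>1 z)" if "z \<in> carrier ?K1" for z
    unfolding arr_boundary_def
  proof (rule colim_bar_boundary_coords[OF hom(2) \<alpha>1_inj hom(1) \<alpha>0_inj _ _ that])
    fix x fs assume "fs \<in> bar_chains C (Suc 0) x"
    then obtain f g where "fs = [f, g]" "f \<in> Arr C" "g \<in> Arr C" "Cod C f = Dom C g"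
      by (elim bar_chains_1E)
    \<comment> \<open>The faces \<open>[g]\<close> and \<open>[Comp C f g]\<close> have sources
      \<open>Cod C f\<close> and \<open>Dom C f\<close>.\<close>
    then show "frag_extend (\<lambda>fs. frag_of (Dom C (hd fs))) (bar_boundary C 0 x (frag_of fs))
        = frag_of (Cod C (hd fs)) - frag_of (Dom C (hd fs))"
      by (simp add: bar_boundary_pair frag_extend_diff Dom_Comp)
  qed (simp_all add: keys_diff_subset Cod_in Dom_in)
  have \<alpha>1_d: "\<alpha>1 (?d1 w) = pair_boundary C (\<alpha>2 w)" if "w \<in> carrier ?K2" for w
    unfolding pair_boundary_def
  proof (rule colim_bar_boundary_coords[OF hom(3) \<alpha>2_inj hom(2) \<alpha>1_inj _ _ that])
    fix x fs assume "fs \<in> bar_chains C (Suc (Suc 0)) x"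
    then obtain f g h where "fs = [f, g, h]" by (elim bar_chains_2E)
    \<comment> \<open>The last face \<open>[f, Comp C g h]\<close> contributes
      \<open>frag_of f\<close>, because \<open>hd\<close> does not see the absorbed
      \<open>h\<close>.\<close>
    then show "frag_extend (\<lambda>fs. frag_of (hd fs)) (bar_boundary C (Suc 0) x (frag_of fs))
        = (case (hd fs, fs ! 1) of (f, g) \<Rightarrow> frag_of g - frag_of (Comp C f g) + frag_of f)"
      by (simp add: bar_boundary_def frag_extend_add frag_extend_diff frag_extend_minus bar_face_def)
  next
    fix k assume "k \<in> composable C"
    then obtain f g where "k = (f, g)" "f \<in> Arr C" "g \<in> Arr C" "Comp C f g \<in> Arr C"
      by (auto simp: composable_def Comp_in)
    then show "Poly_Mapping.keys (case k of (f, g) \<Rightarrow> frag_of g - frag_of (Comp C f g) + frag_of f) \<subseteq> Arr C"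
      by (simp add: keys_add_subset keys_diff_subset)
  qed auto
  show thesis
  proof (rule that[OF \<alpha>1])
    fix z assume z: "z \<in> carrier ?K1"
    have one: "\<alpha>0 \<one>\<^bsub>?K0\<^esub> = 0"
      using hom_one[OF hom(1) gK group_free_Abelian_group] by simp
    show "?d0 z = \<one>\<^bsub>?K0\<^esub> \<longleftrightarrow> arr_boundary C (\<alpha>1 z) = 0"
      unfolding \<alpha>0_d[OF z, symmetric] one[symmetric]
      using inj_on_eq_iff[OF inj(1) hom_in_carrier[OF d(1) z]] group.is_monoid[OF gK]
      by (simp add: monoid.one_closed)
    show "z \<in> ?d1 ` carrier ?K2 \<longleftrightarrow> \<alpha>1 z \<in> bounding C"
    proof
      assume "z \<in> ?d1 ` carrier ?K2"
      then obtain w where "w \<in> carrier ?K2" "z = ?d1 w" by blast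
      then show "\<alpha>1 z \<in> bounding C"
        using \<alpha>1_d[of w] hom_in_carrier[OF hom(3), of w] by (auto simp: bounding_def)
    next
      assume "\<alpha>1 z \<in> bounding C"
      then obtain c where c: "\<alpha>1 z = pair_boundary C c" "c \<in> carrier (free_Abelian_group (composable C))"
        by (auto simp: bounding_def)
      with surj obtain w where w: "w \<in> carrier ?K2" "c = \<alpha>2 w" by (metis imageE)
      have "z = ?d1 w"
        by (rule inj_onD[OF inj(2)]) (use c w z \<alpha>1_d hom_in_carrier[OF d(1)] in auto)
      with w show "z \<in> ?d1 ` carrier ?K2" by blast
    qed
  qed
qed

text \<open>The maps \<open>\<phi>\<close> and \<open>\<theta>\<close> read off and realise the coordinates of a cycle; \<open>p x\<close> plays
  the role of a path from \<open>x\<close> to a base point in a spanning tree, so that \<open>f + p (Cod f) - p (Dom f)\<close>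
  is the loop defined by \<open>f\<close>.\<close>

lemma free_homology_1:
  assumes \<phi>_in: "\<And>f. f \<in> Arr C \<Longrightarrow> Poly_Mapping.keys (\<phi> f) \<subseteq> S"
    and \<phi>_Comp: "\<And>f g. \<lbrakk>f \<in> Arr C; g \<in> Arr C; Cod C f = Dom C g\<rbrakk> \<Longrightarrow> \<phi> (Comp C f g) = \<phi> f + \<phi> g"
    and \<theta>_in: "\<And>s. s \<in> S \<Longrightarrow> Poly_Mapping.keys (\<theta> s) \<subseteq> Arr C"
    and \<theta>_cycle: "\<And>s. s \<in> S \<Longrightarrow> arr_boundary C (\<theta> s) = 0"
    and \<phi>_\<theta>: "\<And>s. s \<in> S \<Longrightarrow> frag_extend \<phi> (\<theta> s) = frag_of s"
    and loop: "\<And>f. f \<in> Arr C \<Longrightarrow>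
      frag_of f + p (Cod C f) - p (Dom C f) - frag_extend \<theta> (\<phi> f) \<in> bounding C"
  shows "is_free_abelian (colim_derived_int C 1)"
proof -
  let ?K1 = "colim C (bar C (Suc 0))" and ?F = "free_Abelian_group S"
  let ?d0 = "colim_map C (bar C 0) (bar_boundary C 0)"
    and ?d1 = "colim_map C (bar C (Suc 0)) (bar_boundary C (Suc 0))"
  let ?Z = "kernel ?K1 (colim C (bar C 0)) ?d0"
    and ?B = "?d1 ` carrier (colim C (bar C (Suc (Suc 0))))"
  obtain \<alpha> where \<alpha>: "\<alpha> \<in> iso ?K1 (free_Abelian_group (Arr C))"
    and cycle: "\<And>z. z \<in> carrier ?K1 \<Longrightarrow> ?d0 z = \<one>\<^bsub>colim C (bar C 0)\<^esub> \<longleftrightarrow> arr_boundary C (\<alpha> z) = 0"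
    and bounds: "\<And>z. z \<in> carrier ?K1 \<Longrightarrow> z \<in> ?B \<longleftrightarrow> \<alpha> z \<in> bounding C"
    by (rule colim_bar_coords) blast
  have \<alpha>_hom: "\<alpha> \<in> hom ?K1 (free_Abelian_group (Arr C))"
    and \<alpha>_surj: "\<alpha> ` carrier ?K1 = carrier (free_Abelian_group (Arr C))"
    using \<alpha> by (simp_all add: iso_def bij_betw_def)
  have gK: "group (colim C (bar C n))" for n
    using ab_diagram.comm_group_colim[OF ab_diagram_bar] by (rule comm_group.axioms(2))
  note d = colim_map_hom_inj(1)[OF ab_diagram_bar ab_diagram_bar nat_trans_bar_boundary]
  interpret d0: group_hom ?K1 "colim C (bar C 0)" ?d0
    by (simp add: group_hom_def group_hom_axioms_def gK d)
  have gZ: "group (?K1\<lparr>carrier := ?Z\<rparr>)"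
    by (rule subgroup.subgroup_is_group[OF d0.subgroup_kernel gK])
  have Z_iff: "z \<in> ?Z \<longleftrightarrow> z \<in> carrier ?K1 \<and> arr_boundary C (\<alpha> z) = 0" for z
    using cycle by (auto simp: kernel_def)
  have B_iff: "z \<in> ?B \<longleftrightarrow> z \<in> carrier ?K1 \<and> \<alpha> z \<in> bounding C" for z
    using bounds hom_in_carrier[OF d] by blast
  \<comment> \<open>Restricted to the cycles \<open>?Z\<close>, this map will have kernel
    \<open>?B\<close> and image \<open>?F\<close>, so the first isomorphism theorem applies.\<close>
  let ?P = "frag_extend \<phi> \<circ> \<alpha>"
  have P: "?P \<in> hom ?K1 ?F"
    by (rule hom_compose[OF \<alpha>_hom hom_frag_extend[OF \<phi>_in]])
  interpret P: group_hom "?K1\<lparr>carrier := ?Z\<rparr>" ?F ?P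
    using P gZ by (auto simp: group_hom_def group_hom_axioms_def hom_def kernel_def)
  \<comment> \<open>Additivity of \<open>\<phi>\<close> on composites cancels the three faces of a
    2-simplex.\<close>
  have \<phi>_bounding: "frag_extend \<phi> c = 0" if c: "c \<in> bounding C" for c
  proof -
    from c obtain d where d: "c = pair_boundary C d" "Poly_Mapping.keys d \<subseteq> composable C"
      by (auto simp: bounding_def)
    have "frag_extend \<phi> (pair_boundary C d) = 0"
      unfolding pair_boundary_def frag_extend_frag_extend
      by (rule frag_extend_eq_0)
        (use d(2) in \<open>auto simp: composable_def frag_extend_add frag_extend_diff \<phi>_Comp\<close>)
    with d show ?thesis by simp
  qed
  \<comment> \<open>The linear extension of \<open>loop\<close>: the path terms add up to
    \<open>p\<close> applied to the boundary of \<open>c\<close>. They vanish for a cycle, which is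
    therefore homologous to the combination of the \<open>\<theta> s\<close> given by its
    coordinates.\<close>
  have homologous: "c + frag_extend p (arr_boundary C c) - frag_extend \<theta> (frag_extend \<phi> c) \<in> bounding C"
    if c: "Poly_Mapping.keys c \<subseteq> Arr C" for c
    using c
  proof (induction rule: frag_induction)
    case (one f)
    with loop[of f] show ?case by (simp add: arr_boundary_def frag_extend_diff algebra_simps)
  next
    case (diff a b)
    from bounding_diff[OF diff] show ?case
      by (simp add: arr_boundary_def frag_extend_diff algebra_simps)
  qed (simp_all add: arr_boundary_def bounding_0)
  have kernel: "kernel (?K1\<lparr>carrier := ?Z\<rparr>) ?F ?P = ?B"
  proof (intro equalityI subsetI)
    fix z assume "z \<in> kernel (?K1\<lparr>carrier := ?Z\<rparr>) ?F ?P"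
    then have z: "z \<in> carrier ?K1" "arr_boundary C (\<alpha> z) = 0" "frag_extend \<phi> (\<alpha> z) = 0"
      by (auto simp: kernel_def[of "?K1\<lparr>carrier := ?Z\<rparr>"] Z_iff)
    with homologous[of "\<alpha> z"] hom_in_carrier[OF \<alpha>_hom z(1)] show "z \<in> ?B"
      by (simp add: B_iff)
  next
    fix z assume "z \<in> ?B"
    then show "z \<in> kernel (?K1\<lparr>carrier := ?Z\<rparr>) ?F ?P"
      using \<phi>_bounding[of "\<alpha> z"] arr_boundary_bounding[OF small_category_axioms, of "\<alpha> z"]
      by (simp add: kernel_def[of "?K1\<lparr>carrier := ?Z\<rparr>"] Z_iff B_iff)
  qed
  have "?P ` ?Z = carrier ?F"
  proof
    show "?P ` ?Z \<subseteq> carrier ?F"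
      using hom_in_carrier[OF P] by (auto simp: kernel_def)
    show "carrier ?F \<subseteq> ?P ` ?Z"
    proof
      fix c assume "c \<in> carrier ?F"
      then have c: "Poly_Mapping.keys c \<subseteq> S" by simp
      have "Poly_Mapping.keys (frag_extend \<theta> c) \<subseteq> Arr C"
        by (rule keys_frag_extend_subset[OF \<theta>_in c])
      then have "frag_extend \<theta> c \<in> \<alpha> ` carrier ?K1" by (simp add: \<alpha>_surj)
      then obtain z where z: "z \<in> carrier ?K1" "frag_extend \<theta> c = \<alpha> z" by blast
      have "arr_boundary C (frag_extend \<theta> c) = frag_extend (\<lambda>s. arr_boundary C (\<theta> s)) c"
        by (simp add: arr_boundary_def frag_extend_frag_extend)
      also have "\<dots> = 0"
        by (rule frag_extend_eq_0) (use c \<theta>_cycle in auto)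
      finally have "z \<in> ?Z" using z by (simp add: Z_iff)
      moreover have "?P z = c"
      proof -
        have "?P z = frag_extend (\<lambda>s. frag_extend \<phi> (\<theta> s)) c"
          by (simp add: z(2)[symmetric] frag_extend_frag_extend)
        also have "\<dots> = frag_extend frag_of c"
          by (rule frag_extend_eq) (use c \<phi>_\<theta> in auto)
        finally show ?thesis using frag_expansion[of c] by simp
      qed
      ultimately show "c \<in> ?P ` ?Z" by blast
    qed
  qed
  then have "(?K1\<lparr>carrier := ?Z\<rparr>) Mod ?B \<cong> ?F"
    using P.FactGroup_iso unfolding kernel by simp
  moreover have "group ((?K1\<lparr>carrier := ?Z\<rparr>) Mod ?B)"
    using normal.factorgroup_is_group[OF P.normal_kernel] unfolding kernel .
  ultimately show ?thesis
    by (simp add: colim_derived_int_def colim_homology_def colim_cycles_def is_free_abelianI)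
qed

text \<open>Every arrow is an identity and bounds, so the empty basis serves.\<close>

lemma free_homology_1_discrete:
  assumes "Arr C = Ident C ` Obj C"
  shows "is_free_abelian (colim_derived_int C 1)"
proof (rule free_homology_1[of "\<lambda>_. 0" "{} :: unit set" "\<lambda>_. 0" "\<lambda>_. 0"])
qed (use assms bounding_Ident in auto)

end

section \<open>The categories of the pointed sets \<open>X\<^sub>m\<close>\<close>

lemma mset_cat_simps [simp]:
  "Obj (mset_cat M X act) = X"
  "(x, \<mu>, y) \<in> Arr (mset_cat M X act) \<longleftrightarrow> x \<in> X \<and> \<mu> \<in> carrier M \<and> y \<in> X \<and> act x \<mu> = y"
  "Dom (mset_cat M X act) (x, \<mu>, y) = x"
  "Cod (mset_cat M X act) (x, \<mu>, y) = y"
  "Ident (mset_cat M X act) x = (x, \<one>\<^bsub>M\<^esub>, x)"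
  "Comp (mset_cat M X act) (x, \<mu>, y) (x', \<nu>, z) = (x, \<mu> \<otimes>\<^bsub>M\<^esub> \<nu>, z)"
  by (simp_all add: mset_cat_def)

section \<open>The points and sums along their orbits\<close>

lemma foldl_X_gen_in: "x \<in> X_set m \<Longrightarrow> foldl (X_gen m) x u \<in> X_set m"
  by (induction u arbitrary: x) (auto simp: X_gen_in)

lemma X_gen_indep: "X_gen m x a = X_gen m x b"
  by (cases x) auto

text \<open>Downward induction from the base point along the action. All generators move a point
  alike, so any \<open>e\<close> may name the successor.\<close>

lemma X_set_induct [consumes 1, case_names Base Pt]:
  assumes "x \<in> X_set m" and "P Base"
    and "\<And>i. \<lbrakk>int i \<le> m; P (X_gen m (Pt i) e)\<rbrakk> \<Longrightarrow> P (Pt i)"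
  shows "P x"
proof -
  have "int i \<le> m \<longrightarrow> P (Pt i)" for i
  proof (induction "nat m - i" arbitrary: i)
    case 0
    then have "\<not> int i < m" by linarith
    with assms(2) assms(3)[of i] show ?case by auto
  next
    case (Suc k)
    then have "k = nat m - Suc i" "int i < m" by linarith+
    with Suc(1)[of "Suc i"] assms(3)[of i] show ?case by auto
  qed
  with assms(1,2) show ?thesis by (auto simp: X_set_def)
qed

definition sum_from :: "int \<Rightarrow> (nat \<Rightarrow> 'a::comm_monoid_add) \<Rightarrow> point \<Rightarrow> 'a" where
  "sum_from m f x = (case x of Base \<Rightarrow> 0 | Pt i \<Rightarrow> \<Sum>j=i..nat m. f j)"

lemma sum_from_Base [simp]: "sum_from m f Base = 0"
  by (simp add: sum_from_def)

text \<open>At \<open>x\<^sub>m\<close> the successor is \<open>Base\<close>, where the sum is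
  empty, so one recursion covers all points and later sums telescope without a case
  distinction.\<close>

lemma sum_from_Pt:
  assumes "int i \<le> m"
  shows "sum_from m f (Pt i) = f i + sum_from m f (X_gen m (Pt i) e)"
proof (cases "int i < m")
  case True
  then have "i \<le> nat m" by linarith
  with True show ?thesis by (simp add: sum_from_def sum.atLeast_Suc_atMost)
next
  case False
  with assms have "i = nat m" "int i = m" by linarith+
  then show ?thesis by (simp add: sum_from_def)
qed

text \<open>The generator \<open>e0\<close> is the \<open>c\<close> of the overview, whose arrows at
  the points other than \<open>Base\<close> form the spanning tree.\<close>

locale trace_points =
  fixes E :: "'e set" and I :: "('e \<times> 'e) set" and m :: int and e0 :: 'e
  assumes I_sub: "I \<subseteq> E \<times> E" and sym_I: "sym I" and e0: "e0 \<in> E"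
begin

abbreviation "K \<equiv> mset_cat (trace_monoid E I) (X_set m) (X_act m)"
abbreviation "R \<equiv> trace_rel E I"

sublocale K: small_category K
  by (rule right_mset.small_category_mset_cat[OF right_mset_X[OF I_sub]])

definition arr :: "point \<Rightarrow> 'e list \<Rightarrow> point \<times> 'e list set \<times> point" where
  "arr x u = (x, R `` {u}, foldl (X_gen m) x u)"

lemma class_in: "u \<in> lists E \<Longrightarrow> R `` {u} \<in> carrier (trace_monoid E I)"
  by (simp add: trace_monoid_def quotientI)

lemma arr_in: "\<lbrakk>x \<in> X_set m; u \<in> lists E\<rbrakk> \<Longrightarrow> arr x u \<in> Arr K"
  by (simp add: arr_def class_in X_act_class foldl_X_gen_in)

lemma Dom_arr [simp]: "Dom K (arr x u) = x"
  and Cod_arr [simp]: "Cod K (arr x u) = foldl (X_gen m) x u"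
  by (simp_all add: arr_def)

lemma Comp_arr:
  "\<lbrakk>u \<in> lists E; v \<in> lists E\<rbrakk> \<Longrightarrow> Comp K (arr x u) (arr (foldl (X_gen m) x u) v) = arr x (u @ v)"
  by (simp add: arr_def trace_monoid_mult[OF I_sub])

lemma arr_Nil: "arr x [] = Ident K x"
  by (simp add: arr_def trace_monoid_def)

lemma Arr_cases:
  assumes "f \<in> Arr K"
  obtains x u where "f = arr x u" "x \<in> X_set m" "u \<in> lists E"
proof -
  obtain x \<mu> y where f: "f = (x, \<mu>, y)" by (cases f)
  with assms have *: "x \<in> X_set m" "\<mu> \<in> carrier (trace_monoid E I)" "X_act m x \<mu> = y" by auto
  then obtain u where "u \<in> lists E" "\<mu> = R `` {u}"
    by (auto simp: trace_monoid_def elim!: quotientE)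
  with * that[of x u] f show ?thesis by (simp add: arr_def X_act_class)
qed

section \<open>Connected components of the graph \<open>(E, I)\<close>\<close>

definition comp_of :: "'e \<Rightarrow> 'e set" where "comp_of e = I\<^sup>* `` {e}"

text \<open>The component of \<open>e0\<close> is represented by \<open>e0\<close> itself, so that
  its cycles d_j(r) - d_j(e0) vanish, in agreement with \<open>square\<close>.\<close>

definition rep :: "'e set \<Rightarrow> 'e" where "rep A = (if e0 \<in> A then e0 else SOME e. e \<in> A)"

lemma comp_of_eq: "(a, b) \<in> I\<^sup>* \<Longrightarrow> comp_of a = comp_of b"
  unfolding comp_of_def
  using sym_rtrancl[OF sym_I, THEN symD, of a b] by (auto intro: rtrancl_trans)

lemma rep_comp_of: "(e, rep (comp_of e)) \<in> I\<^sup>*"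
proof -
  have "rep (comp_of e) \<in> comp_of e"
    unfolding rep_def using someI[of "\<lambda>b. b \<in> comp_of e" e] by (auto simp: comp_of_def)
  then show ?thesis by (simp add: comp_of_def)
qed

lemma rep_in: "e \<in> E \<Longrightarrow> rep (comp_of e) \<in> E"
  using rep_comp_of[of e] I_sub by (auto elim: rtranclE)

lemma comp_of_rep: "comp_of (rep (comp_of e)) = comp_of e"
  using comp_of_eq[OF rep_comp_of] by simp

lemma rep_comp_of_e0: "rep (comp_of e0) = e0"
  by (simp add: rep_def comp_of_def)

abbreviation gen :: "point \<Rightarrow> 'e \<Rightarrow> point \<times> 'e list set \<times> point \<Rightarrow>\<^sub>0 int" where
  "gen x e \<equiv> frag_of (arr x [e])"

abbreviation nxt :: "point \<Rightarrow> point" where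
  "nxt x \<equiv> X_gen m x e0"

text \<open>\<open>Inl e\<close> stands for the loop \<open>e\<close> at the base point, \<open>Inr (j, A)\<close> for the cycle
  \<open>d\<^sub>j(r) - d\<^sub>j(e0)\<close>, where \<open>r\<close> represents the component \<open>A\<close>.\<close>

definition basis :: "('e + nat \<times> 'e set) set" where
  "basis = Inl ` E \<union> Inr ` ({j. int j \<le> m} \<times> (comp_of ` E - {comp_of e0}))"

definition square :: "'e set \<Rightarrow> nat \<Rightarrow> 'e + nat \<times> 'e set \<Rightarrow>\<^sub>0 int" where
  "square A j = (if A = comp_of e0 then 0 else frag_of (Inr (j, A)))"

text \<open>The generator \<open>e\<close> at \<open>x\<^sub>i\<close>, closed up through the tree,
  is the loop \<open>e\<^sub>i - c\<^sub>i\<close>. Telescoping writes it as the sum of d_j(e) -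
  d_j(c) for j from i to m, plus the difference of the loops \<open>e\<close> and \<open>c\<close>
  at \<open>Base\<close>.\<close>

definition coord :: "point \<Rightarrow> 'e \<Rightarrow> 'e + nat \<times> 'e set \<Rightarrow>\<^sub>0 int" where
  "coord x e = sum_from m (square (comp_of e)) x
     + (if x = Base then frag_of (Inl e) else frag_of (Inl e) - frag_of (Inl e0))"

fun word_coord :: "point \<Rightarrow> 'e list \<Rightarrow> 'e + nat \<times> 'e set \<Rightarrow>\<^sub>0 int" where
  "word_coord x [] = 0"
| "word_coord x (e # u) = coord x e + word_coord (X_gen m x e) u"

text \<open>The chosen word is immaterial by \<open>word_coord_trace_rel\<close>.\<close>

definition arr_coord :: "point \<times> 'e list set \<times> point \<Rightarrow> 'e + nat \<times> 'e set \<Rightarrow>\<^sub>0 int" where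
  "arr_coord f = (case f of (x, \<mu>, y) \<Rightarrow> word_coord x (SOME w. w \<in> \<mu>))"

definition cycle :: "'e + nat \<times> 'e set \<Rightarrow> point \<times> 'e list set \<times> point \<Rightarrow>\<^sub>0 int" where
  "cycle s = (case s of Inl e \<Rightarrow> gen Base e
     | Inr (j, A) \<Rightarrow> gen (Pt j) (rep A) - gen (nxt (Pt j)) (rep A)
         - (gen (Pt j) e0 - gen (nxt (Pt j)) e0))"

lemma word_coord_append:
  "word_coord x (u @ v) = word_coord x u + word_coord (foldl (X_gen m) x u) v"
  by (induction u arbitrary: x) (simp_all add: add.assoc)

text \<open>Apart from the summand \<open>Inl e\<close>, which is the same at every point,
  \<open>coord x e\<close> depends on \<open>e\<close> only through its component. Swapping two
  related letters thus leaves the total unchanged.\<close>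

lemma word_coord_trace_rel: "(u, v) \<in> R \<Longrightarrow> word_coord x u = word_coord x v"
proof (induction arbitrary: x rule: trace_rel.induct)
  case (trace_comm a b)
  have "comp_of a = comp_of b" using trace_comm by (intro comp_of_eq) auto
  then have "coord x a + coord (nxt x) b = coord x b + coord (nxt x) a" for x
    by (cases x) (simp_all add: coord_def algebra_simps)
  then show ?case using X_gen_indep by (metis add.right_neutral word_coord.simps)
next
  case (trace_append u v u' v')
  then show ?case
    using foldl_X_gen_trace_rel[OF trace_append(1), of m x] by (simp add: word_coord_append)
qed auto

lemma arr_coord_arr: "u \<in> lists E \<Longrightarrow> arr_coord (arr x u) = word_coord x u"
  using someI[of "\<lambda>w. w \<in> R `` {u}" u] trace_refl[of u E I] word_coord_trace_rel[of u]
  by (simp add: arr_coord_def arr_def)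

lemma keys_coord:
  assumes "x \<in> X_set m" "e \<in> E"
  shows "Poly_Mapping.keys (coord x e) \<subseteq> basis"
proof -
  have "Poly_Mapping.keys (sum_from m (square (comp_of e)) x) \<subseteq> basis"
    using assms(1)
  proof (induction rule: X_set_induct[where e = e0])
    case (Pt i)
    have "Poly_Mapping.keys (square (comp_of e) i) \<subseteq> basis"
      using Pt(1) assms(2) by (auto simp: square_def basis_def)
    with Pt show ?case by (simp add: sum_from_Pt[of i m _ e0] keys_add_subset)
  qed simp
  moreover have "Inl e \<in> basis" "Inl e0 \<in> basis"
    using assms(2) e0 by (auto simp: basis_def)
  ultimately show ?thesis
    by (simp add: coord_def keys_add_subset keys_diff_subset)
qed

lemma keys_word_coord:
  "\<lbrakk>x \<in> X_set m; u \<in> lists E\<rbrakk> \<Longrightarrow> Poly_Mapping.keys (word_coord x u) \<subseteq> basis"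
  by (induction u arbitrary: x) (simp_all add: keys_add_subset keys_coord X_gen_in)

section \<open>Homologies between tree loops and the basis cycles\<close>

lemma cycle_square:
  assumes "e \<in> E"
  shows "frag_extend cycle (square (comp_of e) j) =
    gen (Pt j) (rep (comp_of e)) - gen (nxt (Pt j)) (rep (comp_of e))
      - (gen (Pt j) e0 - gen (nxt (Pt j)) e0)"
  by (simp add: square_def cycle_def rep_comp_of_e0)

text \<open>The differences between successive points telescope, leaving the terms at
  \<open>x\<close> and at \<open>Base\<close>.\<close>

lemma cycle_sum_from:
  assumes "x \<in> X_set m" "e \<in> E"
  shows "frag_extend cycle (sum_from m (square (comp_of e)) x) =
    gen x (rep (comp_of e)) - gen x e0 - (gen Base (rep (comp_of e)) - gen Base e0)"
  using assms(1)
proof (induction rule: X_set_induct[where e = e0])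
  case (Pt i)
  have "frag_extend cycle (sum_from m (square (comp_of e)) (Pt i))
      = frag_extend cycle (square (comp_of e) i)
        + frag_extend cycle (sum_from m (square (comp_of e)) (nxt (Pt i)))"
    using Pt(1) by (simp only: sum_from_Pt[of i m _ e0] frag_extend_add)
  then show ?case unfolding Pt(2) cycle_square[OF assms(2)] by (simp add: algebra_simps)
qed simp

text \<open>The 2-simplices \<open>(a, b)\<close> and \<open>(b, a)\<close> starting at
  \<open>x\<close> have the same composite, which cancels in the difference of their
  boundaries.\<close>

lemma gen_diff_comm:
  assumes ab: "(a, b) \<in> I" and x: "x \<in> X_set m"
  shows "gen x a - gen x b - (gen (nxt x) a - gen (nxt x) b) \<in> bounding K"
proof -
  have ab_in: "a \<in> E" "b \<in> E" using ab I_sub by auto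
  have nx: "nxt x \<in> X_set m" using x by (rule X_gen_in)
  have *: "gen (nxt x) d - frag_of (arr x [c, d]) + gen x c \<in> bounding K" if "c \<in> E" "d \<in> E" for c d
    using bounding_Comp[of "arr x [c]" K "arr (nxt x) [d]"] Comp_arr[of "[c]" "[d]" x] that x nx
      X_gen_indep[of m x c e0] by (simp add: arr_in)
  have "arr x [a, b] = arr x [b, a]"
  proof -
    have "([a, b], [b, a]) \<in> R" using ab by (rule trace_comm)
    then show ?thesis
      using equiv_class_eq[OF equiv_trace_rel[OF I_sub]] foldl_X_gen_trace_rel[of "[a, b]" "[b, a]" E I m x]
      by (simp add: arr_def)
  qed
  with bounding_diff[OF *[of a b] *[of b a]] ab_in show ?thesis
    by (simp add: algebra_simps)
qed

lemma gen_diff_connected: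
  assumes x: "x \<in> X_set m" and ab: "(a, b) \<in> I\<^sup>*"
  shows "gen x a - gen x b - (gen Base a - gen Base b) \<in> bounding K"
  using ab
proof induction
  case base
  show ?case by (simp add: bounding_0)
next
  case (step b c)
  \<comment> \<open>For a single edge of the graph, the squares at the successive points from
    \<open>x\<close> onwards telescope down to \<open>Base\<close>.\<close>
  have "gen x b - gen x c - (gen Base b - gen Base c) \<in> bounding K"
    using x
  proof (induction rule: X_set_induct[where e = e0])
    case (Pt i)
    then have "Pt i \<in> X_set m" by (simp add: X_set_def)
    from bounding_add[OF gen_diff_comm[OF step(2) this] Pt(2)] show ?case
      by (simp add: algebra_simps)
  qed (simp add: bounding_0)
  from bounding_add[OF step(3) this] show ?case by (simp add: algebra_simps)
qed

definition path :: "point \<Rightarrow> point \<times> 'e list set \<times> point \<Rightarrow>\<^sub>0 int" where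
  "path = sum_from m (\<lambda>j. gen (Pt j) e0)"

text \<open>The chain that \<open>free_homology_1\<close> requires to bound, named in order to state
  its additivity along words.\<close>

definition loop_defect :: "point \<times> 'e list set \<times> point \<Rightarrow> point \<times> 'e list set \<times> point \<Rightarrow>\<^sub>0 int" where
  "loop_defect f = frag_of f + path (Cod K f) - path (Dom K f) - frag_extend cycle (arr_coord f)"

text \<open>Away from \<open>Base\<close> the tree terms cancel, and what remains compares
  \<open>e\<close> with the representative of its component; \<open>gen_diff_connected\<close>
  bounds this. At \<open>Base\<close> the defect is zero.\<close>

lemma loop_defect_gen:
  assumes x: "x \<in> X_set m" and e: "e \<in> E"
  shows "loop_defect (arr x [e]) \<in> bounding K"
proof (cases x)
  case Base
  then show ?thesis using e
    by (simp add: loop_defect_def arr_coord_arr coord_def cycle_def path_def bounding_0)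
next
  case (Pt i)
  let ?r = "rep (comp_of e)"
  have i: "int i \<le> m" using x Pt by (simp add: X_set_def)
  have "path x = gen x e0 + path (nxt x)"
    using i unfolding path_def Pt by (rule sum_from_Pt)
  moreover have "foldl (X_gen m) x [e] = nxt x" by (simp add: X_gen_indep[of m x e e0])
  moreover have "frag_extend cycle (arr_coord (arr x [e])) =
      gen x ?r - gen x e0 - (gen Base ?r - gen Base e0) + (gen Base e - gen Base e0)"
    using e Pt cycle_sum_from[OF x e]
    by (simp add: arr_coord_arr coord_def frag_extend_add frag_extend_diff) (simp add: cycle_def)
  ultimately have "loop_defect (arr x [e]) = gen x e - gen x ?r - (gen Base e - gen Base ?r)"
    by (simp add: loop_defect_def algebra_simps)
  with gen_diff_connected[OF x rep_comp_of[of e]] show ?thesis by simp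
qed

lemma loop_defect_bounding:
  "\<lbrakk>x \<in> X_set m; u \<in> lists E\<rbrakk> \<Longrightarrow> loop_defect (arr x u) \<in> bounding K"
proof (induction u arbitrary: x)
  case Nil
  then show ?case
    using K.bounding_Ident[of x]
    by (simp add: loop_defect_def arr_coord_arr) (simp add: arr_Nil)
next
  case (Cons e u)
  let ?y = "X_gen m x e"
  have y: "?y \<in> X_set m" using Cons.prems(1) by (rule X_gen_in)
  have eu: "e \<in> E" "u \<in> lists E" using Cons.prems(2) by auto
  have B: "frag_of (arr ?y u) - frag_of (arr x (e # u)) + gen x e \<in> bounding K"
    using bounding_Comp[of "arr x [e]" K "arr ?y u"] Comp_arr[of "[e]" u x] eu y Cons.prems(1)
    by (simp add: arr_in)
  \<comment> \<open>The tree paths at the intermediate point \<open>?y\<close> cancel, so the defect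
    is additive up to the boundary of one 2-simplex.\<close>
  have "loop_defect (arr x (e # u)) = loop_defect (arr x [e]) + loop_defect (arr ?y u)
      - (frag_of (arr ?y u) - frag_of (arr x (e # u)) + gen x e)"
    using eu by (simp add: loop_defect_def arr_coord_arr frag_extend_add algebra_simps)
  with bounding_diff[OF bounding_add[OF loop_defect_gen[OF Cons.prems(1) eu(1)] Cons.IH[OF y eu(2)]] B]
  show ?case by simp
qed

section \<open>Boundaries and coordinates of the basis cycles\<close>

lemma basisE:
  assumes "s \<in> basis"
  obtains e where "s = Inl e" "e \<in> E"
  | j e where "s = Inr (j, comp_of e)" "int j \<le> m" "e \<in> E" "comp_of e \<noteq> comp_of e0"
  using assms by (auto simp: basis_def)

lemma Base_in: "Base \<in> X_set m" and Pt_in: "int j \<le> m \<Longrightarrow> Pt j \<in> X_set m"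
  by (auto simp: X_set_def)

lemma keys_cycle:
  assumes "s \<in> basis" shows "Poly_Mapping.keys (cycle s) \<subseteq> Arr K"
proof -
  have g: "Poly_Mapping.keys (gen x e) \<subseteq> Arr K" if "x \<in> X_set m" "e \<in> E" for x e
    using arr_in[of x "[e]"] that by simp
  show ?thesis
    using assms
    by (cases rule: basisE)
      (simp_all add: cycle_def keys_diff_subset g Base_in Pt_in X_gen_in rep_in e0 del: X_gen.simps keys_single)
qed

text \<open>All generators at one point have the same endpoints, so their differences are cycles; at
  \<open>Base\<close> each is a loop.\<close>

lemma arr_boundary_cycle: "arr_boundary K (cycle s) = 0"
proof -
  have g: "arr_boundary K (gen x e) = frag_of (nxt x) - frag_of x" for x e
    using X_gen_indep[of m x e e0] by (simp add: arr_boundary_def)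
  have d: "arr_boundary K (a - b) = arr_boundary K a - arr_boundary K b" for a b
    by (simp add: arr_boundary_def frag_extend_diff)
  show ?thesis
    by (auto simp: cycle_def d g split: sum.split)
qed

lemma arr_coord_cycle:
  assumes "s \<in> basis" shows "frag_extend arr_coord (cycle s) = frag_of s"
proof -
  have g: "arr_coord (arr x [e]) = coord x e" if "e \<in> E" for x e
    using that by (simp add: arr_coord_arr)
  show ?thesis
    using assms
  proof (cases rule: basisE)
    case (1 e)
    then show ?thesis by (simp add: cycle_def g coord_def)
  next
    case (2 j e)
    let ?r = "rep (comp_of e)"
    \<comment> \<open>This form holds at every point, including \<open>Base\<close>, and so also
      covers the case where \<open>nxt (Pt j)\<close> is \<open>Base\<close>.\<close>
    have diff: "coord x ?r - coord x e0 = sum_from m (square (comp_of e)) x + (frag_of (Inl ?r) - frag_of (Inl e0))"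
      for x
    proof -
      have "sum_from m (square (comp_of e0)) x = 0"
        by (simp add: sum_from_def square_def split: point.split)
      then show ?thesis by (simp add: coord_def comp_of_rep)
    qed
    have "frag_extend arr_coord (cycle s)
        = (coord (Pt j) ?r - coord (Pt j) e0) - (coord (nxt (Pt j)) ?r - coord (nxt (Pt j)) e0)"
      using 2 rep_in e0 by (simp add: cycle_def frag_extend_diff g del: X_gen.simps)
    \<comment> \<open>The \<open>Inl\<close> terms at the two points cancel, and the sums differ by
      their first term only.\<close>
    also have "\<dots> = square (comp_of e) j"
      unfolding diff sum_from_Pt[OF 2(2), of _ e0] by simp
    also have "\<dots> = frag_of s"
      using 2 by (simp add: square_def)
    finally show ?thesis .
  qed
qed

lemma is_free_abelian_homology_1: "is_free_abelian (colim_derived_int K 1)"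
proof (rule K.free_homology_1[of arr_coord basis cycle path])
  fix f assume "f \<in> Arr K"
  then obtain x u where f: "f = arr x u" "x \<in> X_set m" "u \<in> lists E" by (rule Arr_cases)
  then show "Poly_Mapping.keys (arr_coord f) \<subseteq> basis"
    by (simp add: arr_coord_arr keys_word_coord)
  show "frag_of f + path (Cod K f) - path (Dom K f) - frag_extend cycle (arr_coord f) \<in> bounding K"
    using loop_defect_bounding f unfolding loop_defect_def by blast
next
  fix f g assume "f \<in> Arr K" "g \<in> Arr K" and fg: "Cod K f = Dom K g"
  then obtain x u y v where "f = arr x u" "u \<in> lists E" "g = arr y v" "v \<in> lists E"
    by (metis Arr_cases)
  with fg show "arr_coord (Comp K f g) = arr_coord f + arr_coord g"
    using Comp_arr[of u v x] by (simp add: arr_coord_arr word_coord_append)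
qed (auto simp: keys_cycle arr_boundary_cycle arr_coord_cycle)

end

theorem theorem1p3:
  fixes E :: "'e set" and I :: "('e \<times> 'e) set" and m :: int
  assumes "I \<subseteq> E \<times> E" and "irrefl I" and "sym I" and "m \<ge> -1"
  shows "is_free_abelian (mset_homology 1 (trace_monoid E I) (X_set m) (X_act m))"
proof (cases "E = {}")
  case True
  let ?K = "mset_cat (trace_monoid E I) (X_set m) (X_act m)"
  interpret X: right_mset "trace_monoid E I" "X_set m" "X_act m"
    by (rule right_mset_X[OF assms(1)])
  interpret small_category ?K
    by (rule X.small_category_mset_cat)
  \<comment> \<open>Without generators there is no \<open>e0\<close> to span a tree, but the monoid
    is trivial and the category discrete.\<close>
  have "carrier (trace_monoid E I) = {\<one>\<^bsub>trace_monoid E I\<^esub>}"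
    using True by (auto simp: trace_monoid_def quotient_def)
  then have "Arr ?K = Ident ?K ` Obj ?K"
    using X.act_one by (auto simp: mset_cat_def)
  then show ?thesis
    unfolding mset_homology_def by (rule free_homology_1_discrete)
next
  case False
  then obtain e0 where "e0 \<in> E" by blast
  then interpret trace_points E I m e0
    using assms by unfold_locales
  show ?thesis
    unfolding mset_homology_def by (rule is_free_abelian_homology_1)
qed

end
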